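(* Let $\mathcal{A}=\bigcup_\alpha X_\alpha$ be a unital strong algebra. Then the Wiener algebra $\mathcal{U}=\bigcup_\alpha Y_\alpha$ associated to $\mathcal{A}$ is a strong algebra.
   Context: Inductive limit of Banach spaces: a complex vector space $X$ with a family $\{X_\alpha:\alpha\in A\}$ of subspaces, $X_\alpha\ne X_\beta$ for $\alpha\neq\beta$, directed under inclusion, with $X=\bigcup_\alpha X_\alpha$; the index set $A$ is directed by $\alpha\le\beta$ iff $X_\alpha\subseteq X_\beta$. Each $X_\alpha$ is a Banach space with norm $\|\cdot\|_\alpha$, and whenever $\alpha\le\beta$ the topology induced by $\|\cdot\|_\beta$ on $X_\alpha$ is coarser than that induced by $\|\cdot\|_\alpha$. $X$ carries the inductive limit topology: the finest locally convex topology making all inclusions $X_\alpha\hookrightarrow X$ continuous. Strong algebra: an inductive limit $\mathcal{A}=\bigcup_{\alpha\in A} X_\alpha$ of Banach spaces which is also an (associative) algebra such that for any $\alpha\in A$ there exists $h(\alpha)\in A$ such that for any $\beta\ge h(\alpha)$ there is a positive constant $A_{\beta,\alpha}$ with $\|ab\|_\beta\le A_{\beta,\alpha}\|a\|_\alpha\|b\|_\beta$ and $\|ba\|_\beta\le A_{\beta,\alpha}\|a\|_\alpha\|b\|_\beta$ for every $a\in X_\alpha$, $b\in X_\beta$. The paper assumes in this section that $\mathcal{A}$ is unital. Wiener algebra associated to $\mathcal{A}$: $Y_\alpha$ is the Banach space of periodic functions $a(t)=\sum_{n\in\mathbb{Z}}a_ne^{int}$, $a_n\in X_\alpha$, on $-\pi\le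 t<\pi$ to $\mathcal{A}$, with $\|a\|_\alpha=\sum_{n\in\mathbb{Z}}\|a_n\|_\alpha<\infty$; $\mathcal{U}=\bigcup_\alpha Y_\alpha$ is the inductive limit of the Banach spaces $Y_\alpha$, with pointwise multiplication (equivalently, convolution of the coefficient sequences). *)

theory Defs
  imports "HOL-Analysis.Analysis" "HOL-Library.Function_Algebras"
begin

text \<open>
  Complex vector spaces and algebras are subspaces and subalgebras of an ambient type, whose
  complex scalar multiplication \<open>s\<close> is passed explicitly. Norms are functions
  on the ambient type that are only constrained on the subspace they belong to.
\<close>

locale complex_algebra = vector_space s
  for s :: "complex \<Rightarrow> 'a::ring \<Rightarrow> 'a" +
  assumes scale_mult_left: "s c x * y = s c (x * y)"
    and scale_mult_right: "x * s c y = s c (x * y)"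


subsection \<open>Normed subspaces\<close>

text \<open>The value 0 outside the subspace is needed because \<open>Metric_space\<close> requires
  symmetry and nonnegativity on the whole type.\<close>

definition norm_dist :: "'a::ab_group_add set \<Rightarrow> ('a \<Rightarrow> real) \<Rightarrow> 'a \<Rightarrow> 'a \<Rightarrow> real" where
  "norm_dist V N x y = (if x \<in> V \<and> y \<in> V then N (x - y) else 0)"

definition norm_topology :: "'a::ab_group_add set \<Rightarrow> ('a \<Rightarrow> real) \<Rightarrow> 'a topology" where
  "norm_topology V N = Metric_space.mtopology V (norm_dist V N)"

definition normed_subspace ::
    "(complex \<Rightarrow> 'a::ab_group_add \<Rightarrow> 'a) \<Rightarrow> 'a set \<Rightarrow> ('a \<Rightarrow> real) \<Rightarrow> bool" where
  "normed_subspace s V N \<longleftrightarrow>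
     module.subspace s V \<and>
     (\<forall>x\<in>V. 0 \<le> N x) \<and>
     (\<forall>x\<in>V. N x = 0 \<longleftrightarrow> x = 0) \<and>
     (\<forall>c. \<forall>x\<in>V. N (s c x) = cmod c * N x) \<and>
     (\<forall>x\<in>V. \<forall>y\<in>V. N (x + y) \<le> N x + N y)"

definition banach_subspace ::
    "(complex \<Rightarrow> 'a::ab_group_add \<Rightarrow> 'a) \<Rightarrow> 'a set \<Rightarrow> ('a \<Rightarrow> real) \<Rightarrow> bool" where
  "banach_subspace s V N \<longleftrightarrow>
     normed_subspace s V N \<and> Metric_space.mcomplete V (norm_dist V N)"


subsection \<open>Inductive limits of Banach spaces\<close>

definition locally_convex_topology ::
    "(complex \<Rightarrow> 'a::ab_group_add \<Rightarrow> 'a) \<Rightarrow> 'a set \<Rightarrow> 'a topology \<Rightarrow> bool" where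
  "locally_convex_topology s E T \<longleftrightarrow>
     topspace T = E \<and>
     continuous_map (prod_topology T T) T (\<lambda>(x, y). x + y) \<and>
     continuous_map (prod_topology euclidean T) T (\<lambda>(c, x). s c x) \<and>
     (\<forall>U. openin T U \<and> 0 \<in> U \<longrightarrow>
        (\<exists>V. openin T V \<and> 0 \<in> V \<and> V \<subseteq> U \<and>
           (\<forall>x\<in>V. \<forall>y\<in>V. \<forall>u::real. 0 \<le> u \<and> u \<le> 1 \<longrightarrow>
              s (complex_of_real u) x + s (complex_of_real (1 - u)) y \<in> V)))"

text \<open>The finest locally convex topology making all inclusions continuous. No Hausdorff
  condition is imposed.\<close>

definition is_inductive_limit_topology ::
    "(complex \<Rightarrow> 'a::ab_group_add \<Rightarrow> 'a) \<Rightarrow> 'a set \<Rightarrow> 'i set \<Rightarrow> ('i \<Rightarrow> 'a set) \<Rightarrow>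
     ('i \<Rightarrow> 'a \<Rightarrow> real) \<Rightarrow> 'a topology \<Rightarrow> bool" where
  "is_inductive_limit_topology s E I X N T \<longleftrightarrow>
     locally_convex_topology s E T \<and>
     (\<forall>\<alpha>\<in>I. continuous_map (norm_topology (X \<alpha>) (N \<alpha>)) T (\<lambda>x. x)) \<and>
     (\<forall>T'. locally_convex_topology s E T' \<and>
           (\<forall>\<alpha>\<in>I. continuous_map (norm_topology (X \<alpha>) (N \<alpha>)) T' (\<lambda>x. x)) \<longrightarrow>
           (\<forall>U. openin T' U \<longrightarrow> openin T U))"

definition inductive_limit_topology ::
    "(complex \<Rightarrow> 'a::ab_group_add \<Rightarrow> 'a) \<Rightarrow> 'a set \<Rightarrow> 'i set \<Rightarrow> ('i \<Rightarrow> 'a set) \<Rightarrow>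
     ('i \<Rightarrow> 'a \<Rightarrow> real) \<Rightarrow> 'a topology" where
  "inductive_limit_topology s E I X N = (THE T. is_inductive_limit_topology s E I X N T)"

text \<open>The index set is ordered by \<open>\<alpha> \<le> \<beta>\<close> iff \<open>X \<alpha> \<subseteq> X \<beta>\<close>; it is nonempty because
  \<open>0 \<in> E\<close>.\<close>

locale banach_inductive_limit = vector_space s
  for s :: "complex \<Rightarrow> 'a::ab_group_add \<Rightarrow> 'a"
    and E :: "'a set" and I :: "'i set" and X :: "'i \<Rightarrow> 'a set"
    and N :: "'i \<Rightarrow> 'a \<Rightarrow> real" and T :: "'a topology" +
  assumes carrier_subspace: "subspace E"
    and carrier_eq: "E = (\<Union>\<alpha>\<in>I. X \<alpha>)"
    and steps_distinct: "inj_on X I"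
    and steps_directed: "\<And>\<alpha> \<beta>. \<alpha> \<in> I \<Longrightarrow> \<beta> \<in> I \<Longrightarrow> \<exists>\<gamma>\<in>I. X \<alpha> \<subseteq> X \<gamma> \<and> X \<beta> \<subseteq> X \<gamma>"
    and steps_banach: "\<And>\<alpha>. \<alpha> \<in> I \<Longrightarrow> banach_subspace s (X \<alpha>) (N \<alpha>)"
    and steps_coarser: "\<And>\<alpha> \<beta> U. \<alpha> \<in> I \<Longrightarrow> \<beta> \<in> I \<Longrightarrow> X \<alpha> \<subseteq> X \<beta> \<Longrightarrow>
      openin (subtopology (norm_topology (X \<beta>) (N \<beta>)) (X \<alpha>)) U \<Longrightarrow>
      openin (norm_topology (X \<alpha>) (N \<alpha>)) U"
    and topology: "is_inductive_limit_topology s E I X N T"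


subsection \<open>Strong algebras\<close>

locale strong_algebra = banach_inductive_limit s E I X N T + complex_algebra s
  for s :: "complex \<Rightarrow> 'a::ring \<Rightarrow> 'a"
    and E :: "'a set" and I :: "'i set" and X :: "'i \<Rightarrow> 'a set"
    and N :: "'i \<Rightarrow> 'a \<Rightarrow> real" and T :: "'a topology" +
  assumes mult_closed: "\<And>a b. a \<in> E \<Longrightarrow> b \<in> E \<Longrightarrow> a * b \<in> E"
    and strong: "\<And>\<alpha>. \<alpha> \<in> I \<Longrightarrow> \<exists>h\<in>I. \<forall>\<beta>\<in>I. X h \<subseteq> X \<beta> \<longrightarrow>
      (\<exists>C>0. \<forall>a\<in>X \<alpha>. \<forall>b\<in>X \<beta>.
         a * b \<in> X \<beta> \<and> N \<beta> (a * b) \<le> C * N \<alpha> a * N \<beta> b \<and>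
         b * a \<in> X \<beta> \<and> N \<beta> (b * a) \<le> C * N \<alpha> a * N \<beta> b)"

locale unital_strong_algebra = strong_algebra s E I X N T
  for s :: "complex \<Rightarrow> 'a::ring \<Rightarrow> 'a"
    and E :: "'a set" and I :: "'i set" and X :: "'i \<Rightarrow> 'a set"
    and N :: "'i \<Rightarrow> 'a \<Rightarrow> real" and T :: "'a topology" +
  assumes unital: "\<exists>e\<in>E. \<forall>a\<in>E. e * a = a \<and> a * e = a"


subsection \<open>The Wiener algebra\<close>

text \<open>\<open>fourier_expansion s V N f c\<close>: \<open>f t\<close> is the sum in \<open>(V, N)\<close> of the absolutely convergent
  series of all \<open>c n * exp (i n t)\<close>. A function \<open>f\<close> on the real line with such an expansion is
  automatically \<open>2 * pi\<close>-periodic. Addition and multiplication of functions are the pointwise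
  ones of \<open>Function_Algebras\<close>.\<close>

definition fourier_expansion ::
    "(complex \<Rightarrow> 'a::ab_group_add \<Rightarrow> 'a) \<Rightarrow> 'a set \<Rightarrow> ('a \<Rightarrow> real) \<Rightarrow>
     (real \<Rightarrow> 'a) \<Rightarrow> (int \<Rightarrow> 'a) \<Rightarrow> bool" where
  "fourier_expansion s V N f c \<longleftrightarrow>
     (\<forall>n. c n \<in> V) \<and>
     (\<lambda>n. N (c n)) summable_on UNIV \<and>
     (\<forall>t. limitin (norm_topology V N) (\<lambda>F. \<Sum>n\<in>F. s (exp (\<i> * of_int n * of_real t)) (c n))
            (f t) (finite_subsets_at_top UNIV))"

definition wiener_space ::
    "(complex \<Rightarrow> 'a::ab_group_add \<Rightarrow> 'a) \<Rightarrow> 'a set \<Rightarrow> ('a \<Rightarrow> real) \<Rightarrow> (real \<Rightarrow> 'a) set" where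
  "wiener_space s V N = {f. \<exists>c. fourier_expansion s V N f c}"

text \<open>For a Banach space \<open>(V, N)\<close> the coefficient sequence is determined by the function.\<close>

definition wiener_coeffs ::
    "(complex \<Rightarrow> 'a::ab_group_add \<Rightarrow> 'a) \<Rightarrow> 'a set \<Rightarrow> ('a \<Rightarrow> real) \<Rightarrow> (real \<Rightarrow> 'a) \<Rightarrow> int \<Rightarrow> 'a" where
  "wiener_coeffs s V N f = (THE c. fourier_expansion s V N f c)"

definition wiener_norm ::
    "(complex \<Rightarrow> 'a::ab_group_add \<Rightarrow> 'a) \<Rightarrow> 'a set \<Rightarrow> ('a \<Rightarrow> real) \<Rightarrow> (real \<Rightarrow> 'a) \<Rightarrow> real" where
  "wiener_norm s V N f = (\<Sum>\<^sub>\<infinity>n. N (wiener_coeffs s V N f n))"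

definition pointwise_scale :: "(complex \<Rightarrow> 'a \<Rightarrow> 'a) \<Rightarrow> complex \<Rightarrow> (real \<Rightarrow> 'a) \<Rightarrow> real \<Rightarrow> 'a" where
  "pointwise_scale s c f = (\<lambda>t. s c (f t))"

definition wiener_carrier ::
    "(complex \<Rightarrow> 'a::ab_group_add \<Rightarrow> 'a) \<Rightarrow> 'i set \<Rightarrow> ('i \<Rightarrow> 'a set) \<Rightarrow> ('i \<Rightarrow> 'a \<Rightarrow> real) \<Rightarrow>
     (real \<Rightarrow> 'a) set" where
  "wiener_carrier s I X N = (\<Union>\<alpha>\<in>I. wiener_space s (X \<alpha>) (N \<alpha>))"

end

theory Submission
  imports Defs
begin

text \<open>
  Everything rests on three facts about the steps, which are Banach spaces \<open>V\<close>, \<open>W\<close>, ... inside an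
  ambient vector space.

  A function has at most one absolutely convergent Fourier expansion in \<open>V\<close>
  (\<open>fourier_coefficient_eq_0\<close>, by averaging over roots of unity). So the Wiener norm is the
  \<open>\<ell>\<^sup>1\<close> norm of the coefficient sequence, and the Wiener space of \<open>V\<close> is a Banach space
  (\<open>banach_step_wiener_space\<close>).

  A bounded inclusion of steps induces a bounded inclusion of Wiener spaces, and constant functions
  give back the inclusion of steps (\<open>wiener_space_inclusion\<close>, \<open>wiener_space_subset_iff\<close>). So the
  Wiener spaces form a directed family with the same order on the indices. Comparing topologies is
  the same as bounding one norm by a multiple of the other (\<open>coarser_iff_bounded\<close>).

  If multiplication maps \<open>V \<times> W\<close> to \<open>W\<close> with constant \<open>C\<close>, then it maps the product of the Wiener spaces
  to the Wiener space of \<open>W\<close> with the same constant (\<open>wiener_product\<close>): writing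
  \<open>f = \<Sum>\<^sub>k c\<^sub>k e\<^bsup>ikt\<^esup>\<close>, the series \<open>\<Sum>\<^sub>k (c\<^sub>k e\<^bsup>ikt\<^esup> g)\<close> converges absolutely in the Wiener space of \<open>W\<close>,
  because multiplying \<open>g\<close> by \<open>c\<^sub>k e\<^bsup>ikt\<^esup>\<close> merely shifts its coefficients and multiplies them by \<open>c\<^sub>k\<close>. Hence
  the index \<open>h(\<alpha>)\<close> and the constants that witness strength of the given algebra also witness strength
  of the Wiener algebra, and closedness under products follows from directedness.

  The inductive limit topology exists for any family of normed steps inside a carrier: it is the
  supremum of all locally convex topologies that make the inclusions continuous
  (\<open>is_inductive_limit_topology_supremum\<close>).
\<close>

section \<open>Existence of the inductive limit topology\<close>

text \<open>The topologies among which the inductive limit topology is the finest.\<close>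

definition admissible_topology ::
    "(complex \<Rightarrow> 'a::ab_group_add \<Rightarrow> 'a) \<Rightarrow> 'a set \<Rightarrow> 'i set \<Rightarrow> ('i \<Rightarrow> 'a set) \<Rightarrow>
     ('i \<Rightarrow> 'a \<Rightarrow> real) \<Rightarrow> 'a topology \<Rightarrow> bool" where
  "admissible_topology s E I X N T \<longleftrightarrow>
     locally_convex_topology s E T \<and>
     (\<forall>\<alpha>\<in>I. continuous_map (norm_topology (X \<alpha>) (N \<alpha>)) T (\<lambda>x. x))"

text \<open>The carrier is added by hand so that the generated topology has the right underlying space
  without exhibiting an admissible topology first.\<close>

definition admissible_subbasis ::
    "(complex \<Rightarrow> 'a::ab_group_add \<Rightarrow> 'a) \<Rightarrow> 'a set \<Rightarrow> 'i set \<Rightarrow> ('i \<Rightarrow> 'a set) \<Rightarrow>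
     ('i \<Rightarrow> 'a \<Rightarrow> real) \<Rightarrow> 'a set set" where
  "admissible_subbasis s E I X N =
     insert E {U. \<exists>T. admissible_topology s E I X N T \<and> openin T U}"

lemma admissible_topspace: "admissible_topology s E I X N T \<Longrightarrow> topspace T = E"
  by (simp add: admissible_topology_def locally_convex_topology_def)

lemma Union_admissible_subbasis: "\<Union>(admissible_subbasis s E I X N) = E"
  by (auto simp: admissible_subbasis_def dest!: admissible_topspace dest: openin_subset)

text \<open>Preimages commute with unions and finite intersections, so only subbasic sets matter, and each of
  them except the carrier is open in a single admissible topology.\<close>

lemma continuous_map_into_admissible_supremum:
  assumes "f \<in> topspace S \<rightarrow> E"
    and "\<And>T. admissible_topology s E I X N T \<Longrightarrow> continuous_map S T f"
  shows "continuous_map S (topology_generated_by (admissible_subbasis s E I X N)) f"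
  unfolding continuous_on_generated_topo_iff Union_admissible_subbasis
proof (intro conjI allI impI)
  show "f ` topspace S \<subseteq> E" using assms(1) by auto
  fix U assume "U \<in> admissible_subbasis s E I X N"
  then consider "U = E" | T where "admissible_topology s E I X N T" "openin T U"
    by (auto simp: admissible_subbasis_def)
  then show "openin S (f -` U \<inter> topspace S)"
  proof cases
    case 1
    then have "f -` U \<inter> topspace S = topspace S" using assms(1) by auto
    then show ?thesis by simp
  next
    case 2
    then have "openin S {x \<in> topspace S. f x \<in> U}"
      using assms(2) openin_continuous_map_preimage by blast
    moreover have "{x \<in> topspace S. f x \<in> U} = f -` U \<inter> topspace S" by auto
    ultimately show ?thesis by simp
  qed
qed

lemma continuous_map_from_admissible_supremum:
  assumes "admissible_topology s E I X N T"
  shows "continuous_map (topology_generated_by (admissible_subbasis s E I X N)) T (\<lambda>x. x)"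
proof -
  have "openin (topology_generated_by (admissible_subbasis s E I X N)) U" if "openin T U" for U
    using that assms by (intro topology_generated_by_Basis) (auto simp: admissible_subbasis_def)
  moreover have "topspace (topology_generated_by (admissible_subbasis s E I X N)) = topspace T"
    using admissible_topspace[OF assms] by (simp add: Union_admissible_subbasis)
  moreover have "{x \<in> topspace T. x \<in> U} = U" if "openin T U" for U
    using openin_subset[OF that] by auto
  ultimately show ?thesis
    unfolding continuous_map_def by simp
qed

text \<open>Finite intersections of convex neighbourhoods are convex neighbourhoods, so local convexity
  only has to be checked on the subbasis.\<close>

lemma admissible_supremum_convex_base:
  assumes sub: "module.subspace s E" and m: "module s"
    and "generate_topology_on (admissible_subbasis s E I X N) U" "0 \<in> U"
  shows "\<exists>V. openin (topology_generated_by (admissible_subbasis s E I X N)) V \<and> 0 \<in> V \<and> V \<subseteq> U \<and>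
           (\<forall>x\<in>V. \<forall>y\<in>V. \<forall>u::real. 0 \<le> u \<and> u \<le> 1 \<longrightarrow>
              s (complex_of_real u) x + s (complex_of_real (1 - u)) y \<in> V)"
  using assms(3,4)
proof (induction rule: generate_topology_on.induct)
  case Empty
  then show ?case by simp
next
  case (Int a b)
  then obtain V W where "openin (topology_generated_by (admissible_subbasis s E I X N)) V" "0 \<in> V" "V \<subseteq> a"
     "\<forall>x\<in>V. \<forall>y\<in>V. \<forall>u::real. 0 \<le> u \<and> u \<le> 1 \<longrightarrow>
              s (complex_of_real u) x + s (complex_of_real (1 - u)) y \<in> V"
    "openin (topology_generated_by (admissible_subbasis s E I X N)) W" "0 \<in> W" "W \<subseteq> b"
     "\<forall>x\<in>W. \<forall>y\<in>W. \<forall>u::real. 0 \<le> u \<and> u \<le> 1 \<longrightarrow>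
              s (complex_of_real u) x + s (complex_of_real (1 - u)) y \<in> W"
    by (elim IntE) metis
  then show ?case by (intro exI[of _ "V \<inter> W"]) auto
next
  case (UN K)
  then obtain k where k: "k \<in> K" "0 \<in> k" by auto
  show ?case using UN.IH[OF k] k(1) by (meson Sup_upper order_trans)
next
  case (Basis U)
  then consider "U = E" | T where "admissible_topology s E I X N T" "openin T U"
    by (auto simp: admissible_subbasis_def)
  then show ?case
  proof cases
    case 1
    then show ?thesis using Basis sub
      by (intro exI[of _ E])
        (auto intro!: topology_generated_by_Basis module.subspace_add[OF m] module.subspace_scale[OF m])
  next
    case 2
    then have "locally_convex_topology s E T" by (simp add: admissible_topology_def)
    then obtain V where V: "openin T V" "0 \<in> V" "V \<subseteq> U"
       "\<forall>x\<in>V. \<forall>y\<in>V. \<forall>u::real. 0 \<le> u \<and> u \<le> 1 \<longrightarrow>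
              s (complex_of_real u) x + s (complex_of_real (1 - u)) y \<in> V"
      using 2(2) Basis(2) unfolding locally_convex_topology_def by metis
    moreover have "openin (topology_generated_by (admissible_subbasis s E I X N)) V"
      using 2(1) V(1) by (intro topology_generated_by_Basis) (auto simp: admissible_subbasis_def)
    ultimately show ?thesis by blast
  qed
qed

text \<open>The supremum of all admissible topologies is again admissible: continuity of the vector space
  operations into a supremum is tested against each member, and the operations stay continuous when
  the topology of the domain is refined.\<close>

theorem is_inductive_limit_topology_supremum:
  assumes vs: "vector_space s" and sub: "module.subspace s E"
    and steps: "\<And>\<alpha>. \<alpha> \<in> I \<Longrightarrow> topspace (norm_topology (X \<alpha>) (N \<alpha>)) \<subseteq> E"
  shows "is_inductive_limit_topology s E I X N
           (topology_generated_by (admissible_subbasis s E I X N))"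
    (is "is_inductive_limit_topology s E I X N ?T")
proof -
  interpret vector_space s by (fact vs)
  have m: "module s" by unfold_locales
  have top: "topspace ?T = E" by (simp add: Union_admissible_subbasis)
  have "locally_convex_topology s E ?T"
    unfolding locally_convex_topology_def
  proof (intro conjI allI impI)
    show "topspace ?T = E" by (fact top)
    show "continuous_map (prod_topology ?T ?T) ?T (\<lambda>(x, y). x + y)"
    proof (rule continuous_map_into_admissible_supremum)
      show "(\<lambda>(x, y). x + y) \<in> topspace (prod_topology ?T ?T) \<rightarrow> E"
        using sub by (auto simp: Union_admissible_subbasis subspace_add)
      fix S assume S: "admissible_topology s E I X N S"
      have "continuous_map (prod_topology ?T ?T) (prod_topology S S) (\<lambda>(x, y). (x, y))"
        unfolding continuous_map_prod_top using continuous_map_from_admissible_supremum[OF S] by simp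
      moreover have "continuous_map (prod_topology S S) S (\<lambda>(x, y). x + y)"
        using S by (simp add: admissible_topology_def locally_convex_topology_def)
      ultimately have "continuous_map (prod_topology ?T ?T) S ((\<lambda>(x, y). x + y) \<circ> (\<lambda>(x, y). (x, y)))"
        by (rule continuous_map_compose)
      then show "continuous_map (prod_topology ?T ?T) S (\<lambda>(x, y). x + y)" by (simp add: o_def)
    qed
    show "continuous_map (prod_topology euclidean ?T) ?T (\<lambda>(c, x). s c x)"
    proof (rule continuous_map_into_admissible_supremum)
      show "(\<lambda>(c, x). s c x) \<in> topspace (prod_topology euclidean ?T) \<rightarrow> E"
        using sub by (auto simp: Union_admissible_subbasis subspace_scale)
      fix S assume S: "admissible_topology s E I X N S"
      have "continuous_map (prod_topology euclidean ?T) (prod_topology euclidean S) (\<lambda>(c, x). (c, x))"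
        unfolding continuous_map_prod_top using continuous_map_from_admissible_supremum[OF S] by simp
      moreover have "continuous_map (prod_topology euclidean S) S (\<lambda>(c, x). s c x)"
        using S by (simp add: admissible_topology_def locally_convex_topology_def)
      ultimately have "continuous_map (prod_topology euclidean ?T) S ((\<lambda>(c, x). s c x) \<circ> (\<lambda>(c, x). (c, x)))"
        by (rule continuous_map_compose)
      then show "continuous_map (prod_topology euclidean ?T) S (\<lambda>(c, x). s c x)" by (simp add: o_def)
    qed
    fix U assume "openin ?T U \<and> 0 \<in> U"
    then show "\<exists>V. openin ?T V \<and> 0 \<in> V \<and> V \<subseteq> U \<and>
           (\<forall>x\<in>V. \<forall>y\<in>V. \<forall>u::real. 0 \<le> u \<and> u \<le> 1 \<longrightarrow>
              s (complex_of_real u) x + s (complex_of_real (1 - u)) y \<in> V)"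
      by (intro admissible_supremum_convex_base[OF sub m]) (auto dest: openin_topology_generated_by)
  qed
  moreover have "continuous_map (norm_topology (X \<alpha>) (N \<alpha>)) ?T (\<lambda>x. x)" if "\<alpha> \<in> I" for \<alpha>
    using steps[OF that] that
    by (intro continuous_map_into_admissible_supremum) (auto simp: admissible_topology_def)
  moreover have "openin ?T U" if "admissible_topology s E I X N S" "openin S U" for S U
    using that by (intro topology_generated_by_Basis) (auto simp: admissible_subbasis_def)
  ultimately show ?thesis
    unfolding is_inductive_limit_topology_def by (auto simp: admissible_topology_def)
qed

lemma is_inductive_limit_topology_unique:
  assumes "is_inductive_limit_topology s E I X N S" "is_inductive_limit_topology s E I X N T"
  shows "S = T"
  using assms unfolding is_inductive_limit_topology_def topology_eq by metis

theorem is_inductive_limit_topology_inductive_limit_topology: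
  assumes "vector_space s" and "module.subspace s E"
    and "\<And>\<alpha>. \<alpha> \<in> I \<Longrightarrow> topspace (norm_topology (X \<alpha>) (N \<alpha>)) \<subseteq> E"
  shows "is_inductive_limit_topology s E I X N (inductive_limit_topology s E I X N)"
  unfolding inductive_limit_topology_def
  using is_inductive_limit_topology_supremum[OF assms]
  by (rule theI) (auto intro: is_inductive_limit_topology_unique is_inductive_limit_topology_supremum[OF assms])


section \<open>Normed subspaces\<close>

locale normed_step = vector_space s
  for s :: "complex \<Rightarrow> 'a::ab_group_add \<Rightarrow> 'a" +
  fixes V :: "'a set" and N :: "'a \<Rightarrow> real"
  assumes normed: "normed_subspace s V N"
begin

lemma step_subspace: "subspace V"
  using normed by (simp add: normed_subspace_def)

lemmas step_0 = subspace_0[OF step_subspace]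
  and step_add = subspace_add[OF step_subspace]
  and step_diff = subspace_diff[OF step_subspace]
  and step_scale = subspace_scale[OF step_subspace]
  and step_sum = subspace_sum[OF step_subspace]

lemma N_nonneg: "x \<in> V \<Longrightarrow> 0 \<le> N x"
  and N_eq_0_iff: "x \<in> V \<Longrightarrow> N x = 0 \<longleftrightarrow> x = 0"
  and N_scale: "x \<in> V \<Longrightarrow> N (s c x) = cmod c * N x"
  and N_triangle: "x \<in> V \<Longrightarrow> y \<in> V \<Longrightarrow> N (x + y) \<le> N x + N y"
  using normed by (auto simp: normed_subspace_def)

lemma N_0 [simp]: "N 0 = 0"
  using N_eq_0_iff step_0 by blast

lemma N_minus: "x \<in> V \<Longrightarrow> N (- x) = N x"
  using N_scale[of x "-1"] by simp

lemma N_diff_commute: "x \<in> V \<Longrightarrow> y \<in> V \<Longrightarrow> N (x - y) = N (y - x)"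
  using N_minus[OF step_diff, of x y] by simp

lemma N_diff_triangle: "x \<in> V \<Longrightarrow> y \<in> V \<Longrightarrow> z \<in> V \<Longrightarrow> N (x - z) \<le> N (x - y) + N (y - z)"
  using N_triangle[OF step_diff step_diff, of x y y z] by simp

lemma N_sum_le: "(\<And>i. i \<in> F \<Longrightarrow> f i \<in> V) \<Longrightarrow> N (sum f F) \<le> (\<Sum>i\<in>F. N (f i))"
proof (induction F rule: infinite_finite_induct)
  case (insert i F)
  then have "N (f i + sum f F) \<le> N (f i) + N (sum f F)"
    by (intro N_triangle step_sum) auto
  then show ?case using insert by auto
qed auto

sublocale dist: Metric_space V "norm_dist V N"
proof
  fix x y z
  show "0 \<le> norm_dist V N x y" by (simp add: norm_dist_def N_nonneg step_diff)
  show "norm_dist V N x y = norm_dist V N y x" by (simp add: norm_dist_def N_diff_commute)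
  show "norm_dist V N x y = 0 \<longleftrightarrow> x = y" if "x \<in> V" "y \<in> V"
    using that by (simp add: norm_dist_def N_eq_0_iff step_diff)
  show "norm_dist V N x z \<le> norm_dist V N x y + norm_dist V N y z" if "x \<in> V" "y \<in> V" "z \<in> V"
    using that by (simp add: norm_dist_def N_diff_triangle)
qed

lemma topspace_norm_topology: "topspace (norm_topology V N) = V"
  by (simp add: norm_topology_def)

lemma openin_norm_topology_iff:
  "openin (norm_topology V N) U \<longleftrightarrow>
     U \<subseteq> V \<and> (\<forall>x\<in>U. \<exists>r>0. \<forall>y\<in>V. N (x - y) < r \<longrightarrow> y \<in> U)"
proof -
  have "dist.mball x r \<subseteq> U \<longleftrightarrow> (\<forall>y\<in>V. N (x - y) < r \<longrightarrow> y \<in> U)" if "x \<in> V" for x r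
    using that by (auto simp: norm_dist_def subset_iff)
  then show ?thesis
    unfolding norm_topology_def dist.openin_mtopology by (metis subset_iff)
qed

lemma limitin_norm_topology_iff:
  assumes "\<And>k. g k \<in> V"
  shows "limitin (norm_topology V N) g x G \<longleftrightarrow> x \<in> V \<and> ((\<lambda>k. N (g k - x)) \<longlongrightarrow> 0) G"
proof -
  have "limitin (norm_topology V N) g x G \<longleftrightarrow>
      x \<in> V \<and> (\<forall>\<epsilon>>0. eventually (\<lambda>k. N (g k - x) < \<epsilon>) G)"
    unfolding norm_topology_def dist.limitin_metric by (auto simp: norm_dist_def assms)
  also have "\<dots> \<longleftrightarrow> x \<in> V \<and> ((\<lambda>k. N (g k - x)) \<longlongrightarrow> 0) G"
    by (auto simp: tendsto_iff dist_real_def assms abs_of_nonneg N_nonneg step_diff)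
  finally show ?thesis .
qed

lemma MCauchy_iff:
  "dist.MCauchy \<sigma> \<longleftrightarrow>
     (\<forall>k. \<sigma> k \<in> V) \<and> (\<forall>\<epsilon>>0. \<exists>K. \<forall>k l. K \<le> k \<longrightarrow> K \<le> l \<longrightarrow> N (\<sigma> k - \<sigma> l) < \<epsilon>)"
  unfolding dist.MCauchy_def norm_dist_def by (auto simp: image_subset_iff)

end

locale banach_step = normed_step +
  assumes complete: "Metric_space.mcomplete V (norm_dist V N)"
begin

lemma Cauchy_has_limit:
  assumes "\<And>k. \<sigma> k \<in> V" "\<And>\<epsilon>. \<epsilon> > 0 \<Longrightarrow> \<exists>K. \<forall>k l. K \<le> k \<longrightarrow> K \<le> l \<longrightarrow> N (\<sigma> k - \<sigma> l) < \<epsilon>"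
  obtains x where "x \<in> V" "(\<lambda>k. N (\<sigma> k - x)) \<longlonglongrightarrow> 0"
proof -
  have "dist.MCauchy \<sigma>" using assms by (simp add: MCauchy_iff)
  then obtain x where "limitin dist.mtopology \<sigma> x sequentially"
    using complete by (auto simp: dist.mcomplete_def)
  then show ?thesis
    using that limitin_norm_topology_iff[where g = \<sigma> and x = x and G = sequentially, OF assms(1)]
    unfolding norm_topology_def by blast
qed

end

lemma banach_step_iff: "banach_step s V N \<longleftrightarrow> vector_space s \<and> banach_subspace s V N"
  by (auto simp: banach_step_def banach_step_axioms_def normed_step_def normed_step_axioms_def
      banach_subspace_def)

text \<open>If the topology of \<open>W\<close> is coarser, then the trace on \<open>V\<close> of the unit ball of \<open>W\<close> contains a
  ball of \<open>V\<close>, and rescaling vectors into that ball gives the bound. The bound is the form in which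
  the comparison of topologies passes to coefficient sequences and back.\<close>

lemma coarser_iff_bounded:
  assumes "normed_step s V N" "normed_step s W M" "V \<subseteq> W"
  shows "(\<forall>U. openin (subtopology (norm_topology W M) V) U \<longrightarrow> openin (norm_topology V N) U) \<longleftrightarrow>
         (\<exists>K>0. \<forall>x\<in>V. M x \<le> K * N x)" (is "?coarser \<longleftrightarrow> ?bounded")
proof
  interpret V: normed_step s V N by fact
  interpret W: normed_step s W M by fact
  {
    assume ?coarser
    let ?B = "{y \<in> W. M y < 1}"
    have "openin (norm_topology W M) ?B"
      unfolding W.openin_norm_topology_iff
    proof (intro conjI ballI)
      fix x assume x: "x \<in> ?B"
      have "M y < 1" if "y \<in> W" "M (x - y) < 1 - M x" for y
        using W.N_triangle[of "y - x" x] that x by (simp add: W.step_diff W.N_diff_commute)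
      then show "\<exists>r>0. \<forall>y\<in>W. M (x - y) < r \<longrightarrow> y \<in> ?B"
        using x by (intro exI[of _ "1 - M x"]) auto
    qed auto
    then have "openin (norm_topology V N) (?B \<inter> V)"
      using \<open>?coarser\<close> by (auto simp: openin_subtopology)
    moreover have "0 \<in> ?B \<inter> V" using V.step_0 W.step_0 by simp
    ultimately obtain r where r: "r > 0" "\<And>y. y \<in> V \<Longrightarrow> N (0 - y) < r \<Longrightarrow> y \<in> ?B \<inter> V"
      unfolding V.openin_norm_topology_iff by blast
    have "M x \<le> 2 / r * N x" if x: "x \<in> V" for x
    proof (cases "x = 0")
      case False
      then have pos: "N x > 0" using V.N_nonneg[OF x] V.N_eq_0_iff[OF x] by simp
      \<comment> \<open>This multiple of \<open>x\<close> has norm \<open>r / 2\<close>, inside the ball of radius \<open>r\<close>.\<close>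
      let ?c = "complex_of_real (r / (2 * N x))"
      have c: "cmod ?c = r / (2 * N x)" using pos r(1) by (simp del: of_real_divide)
      have "N (s ?c x) = r / 2" using pos r(1) by (simp add: V.N_scale[OF x] c del: of_real_divide)
      then have "s ?c x \<in> ?B"
        using r x by (simp add: V.step_scale V.N_minus)
      then have "r / (2 * N x) * M x < 1"
        using x assms(3) pos r(1) by (simp add: W.N_scale c subset_iff del: of_real_divide)
      then show ?thesis using pos r(1) by (simp add: field_simps)
    qed simp
    then show ?bounded using r(1) by (intro exI[of _ "2 / r"]) auto
  }
  {
    assume ?bounded
    then obtain K where K: "K > 0" "\<And>x. x \<in> V \<Longrightarrow> M x \<le> K * N x" by auto
    show ?coarser
    proof (intro allI impI)
      fix U assume "openin (subtopology (norm_topology W M) V) U"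
      then obtain O' where O': "openin (norm_topology W M) O'" "U = O' \<inter> V"
        by (auto simp: openin_subtopology)
      show "openin (norm_topology V N) U"
        unfolding V.openin_norm_topology_iff
      proof (intro conjI ballI)
        fix x assume x: "x \<in> U"
        then obtain r where r: "r > 0" "\<And>y. y \<in> W \<Longrightarrow> M (x - y) < r \<Longrightarrow> y \<in> O'"
          using O' unfolding W.openin_norm_topology_iff by blast
        have "y \<in> U" if "y \<in> V" "N (x - y) < r / K" for y
        proof -
          have "M (x - y) \<le> K * N (x - y)" using x O' that by (intro K V.step_diff) auto
          also have "\<dots> < r" using that(2) K(1) by (simp add: field_simps)
          finally show ?thesis using r(2) that assms(3) O' by auto
        qed
        then show "\<exists>r>0. \<forall>y\<in>V. N (x - y) < r \<longrightarrow> y \<in> U"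
          using r(1) K(1) by (intro exI[of _ "r / K"]) auto
      qed (use O' in auto)
    qed
  }
qed


section \<open>Absolutely convergent series\<close>

lemma summable_on_if_bounded:
  fixes g :: "'b \<Rightarrow> real"
  assumes "\<And>k. 0 \<le> g k" "\<And>F. finite F \<Longrightarrow> sum g F \<le> B"
  shows "g summable_on UNIV" and "infsum g UNIV \<le> B"
proof -
  show *: "g summable_on UNIV"
    using assms by (intro nonneg_bdd_above_summable_on bdd_aboveI[of _ B]) auto
  show "infsum g UNIV \<le> B" using assms(2) by (intro infsum_le_finite_sums[OF *]) auto
qed

lemma infsum_Compl:
  fixes g :: "'b \<Rightarrow> real"
  assumes "g summable_on UNIV" "finite F"
  shows "infsum g (- F) = infsum g UNIV - sum g F"
  using infsum_Un_disjoint[of g F "- F"] assms summable_on_subset_banach[OF assms(1), of "- F"]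
  by simp

lemma tendsto_infsum_Compl:
  fixes g :: "'b \<Rightarrow> real"
  assumes "g summable_on UNIV"
  shows "((\<lambda>F. infsum g (- F)) \<longlongrightarrow> 0) (finite_subsets_at_top UNIV)"
proof -
  have "(sum g \<longlongrightarrow> infsum g UNIV) (finite_subsets_at_top UNIV)"
    using assms has_sum_infsum unfolding has_sum_def by blast
  then have "((\<lambda>F. infsum g UNIV - sum g F) \<longlongrightarrow> 0) (finite_subsets_at_top UNIV)"
    using tendsto_diff[OF tendsto_const, of _ _ _ "infsum g UNIV"] by force
  then show ?thesis
    by (rule Lim_transform_eventually)
      (auto intro!: eventually_finite_subsets_at_top_weakI simp: infsum_Compl[OF assms])
qed

text \<open>Convergence is phrased through the real-valued function of the distance to the limit, so that
  sums, linear images and uniqueness of limits reduce to limits of real numbers.\<close>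

definition absolutely_sums :: "'a::ab_group_add set \<Rightarrow> ('a \<Rightarrow> real) \<Rightarrow> ('b \<Rightarrow> 'a) \<Rightarrow> 'a \<Rightarrow> bool" where
  "absolutely_sums V N f x \<longleftrightarrow>
     (\<forall>k. f k \<in> V) \<and> (\<lambda>k. N (f k)) summable_on UNIV \<and> x \<in> V \<and>
     ((\<lambda>F. N (sum f F - x)) \<longlongrightarrow> 0) (finite_subsets_at_top UNIV)"

context normed_step
begin

lemma absolutely_sums_iff_limitin:
  "absolutely_sums V N f x \<longleftrightarrow>
     (\<forall>k. f k \<in> V) \<and> (\<lambda>k. N (f k)) summable_on UNIV \<and>
     limitin (norm_topology V N) (sum f) x (finite_subsets_at_top UNIV)"
  unfolding absolutely_sums_def by (auto simp: limitin_norm_topology_iff step_sum)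

lemma absolutely_sums_unique:
  assumes "absolutely_sums V N f x" "absolutely_sums V N f y"
  shows "x = y"
proof -
  have in_V: "f k \<in> V" "x \<in> V" "y \<in> V" for k using assms by (auto simp: absolutely_sums_def)
  have "((\<lambda>F. N (sum f F - x) + N (sum f F - y)) \<longlongrightarrow> 0 + 0) (finite_subsets_at_top UNIV)"
    using assms unfolding absolutely_sums_def by (intro tendsto_add) auto
  then have "N (x - y) \<le> 0 + 0"
  proof (rule tendsto_lowerbound)
    have "N (x - y) \<le> N (sum f F - x) + N (sum f F - y)" for F
      using N_diff_triangle[of x "sum f F" y] in_V by (simp add: step_sum N_diff_commute)
    then show "\<forall>\<^sub>F F in finite_subsets_at_top UNIV. N (x - y) \<le> N (sum f F - x) + N (sum f F - y)"
      by simp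
  qed simp
  then show ?thesis using N_nonneg N_eq_0_iff in_V step_diff by (metis add_0 eq_iff_diff_eq_0 order_antisym)
qed

text \<open>The error of a partial sum is at most the sum of the norms of the missing terms. For a Fourier
  series this bound is the same at every point, since the characters have modulus \<open>1\<close>.\<close>

lemma absolutely_sums_tail_le:
  assumes "absolutely_sums V N f x" "finite F"
  shows "N (sum f F - x) \<le> (\<Sum>\<^sub>\<infinity>k\<in>-F. N (f k))"
proof -
  have in_V: "f k \<in> V" "x \<in> V" and sum: "(\<lambda>k. N (f k)) summable_on UNIV" for k
    using assms by (auto simp: absolutely_sums_def)
  have "((\<lambda>G. (\<Sum>\<^sub>\<infinity>k\<in>-F. N (f k)) + N (sum f G - x)) \<longlongrightarrow> (\<Sum>\<^sub>\<infinity>k\<in>-F. N (f k)) + 0)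
      (finite_subsets_at_top UNIV)"
    using assms unfolding absolutely_sums_def by (intro tendsto_add) auto
  then have "N (sum f F - x) \<le> (\<Sum>\<^sub>\<infinity>k\<in>-F. N (f k)) + 0"
  proof (rule tendsto_lowerbound)
    have "N (sum f F - x) \<le> (\<Sum>\<^sub>\<infinity>k\<in>-F. N (f k)) + N (sum f G - x)" if G: "finite G" "F \<subseteq> G" for G
    proof -
      have "N (sum f F - sum f G) = N (sum f (G - F))"
        using G in_V sum_diff[OF G, of f] by (simp add: N_diff_commute step_sum)
      also have "\<dots> \<le> (\<Sum>k\<in>G - F. N (f k))" using in_V by (intro N_sum_le)
      also have "\<dots> \<le> (\<Sum>\<^sub>\<infinity>k\<in>-F. N (f k))"
        using G in_V by (intro finite_sum_le_infsum summable_on_subset_banach[OF sum]) (auto simp: N_nonneg)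
      finally show ?thesis
        using N_diff_triangle[of "sum f F" "sum f G" x] in_V by (simp add: step_sum)
    qed
    then show "\<forall>\<^sub>F G in finite_subsets_at_top UNIV.
        N (sum f F - x) \<le> (\<Sum>\<^sub>\<infinity>k\<in>-F. N (f k)) + N (sum f G - x)"
      using assms(2) by (auto simp: eventually_finite_subsets_at_top intro!: exI[of _ F])
  qed simp
  then show ?thesis by simp
qed

lemma absolutely_sums_norm_le:
  assumes "absolutely_sums V N f x"
  shows "N x \<le> (\<Sum>\<^sub>\<infinity>k. N (f k))"
  using absolutely_sums_tail_le[OF assms, of "{}"] assms by (simp add: N_minus absolutely_sums_def)

lemma absolutely_sums_add:
  assumes "absolutely_sums V N f x" "absolutely_sums V N g y"
  shows "absolutely_sums V N (\<lambda>k. f k + g k) (x + y)"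
proof -
  have in_V: "f k \<in> V" "g k \<in> V" "x \<in> V" "y \<in> V" for k
    using assms by (auto simp: absolutely_sums_def)
  have "(\<lambda>k. N (f k) + N (g k)) summable_on UNIV"
    using assms by (intro summable_on_add) (auto simp: absolutely_sums_def)
  then have "(\<lambda>k. N (f k + g k)) summable_on UNIV"
    by (rule summable_on_comparison_test) (auto simp: in_V N_triangle N_nonneg step_add)
  moreover have "((\<lambda>F. N (sum (\<lambda>k. f k + g k) F - (x + y))) \<longlongrightarrow> 0) (finite_subsets_at_top UNIV)"
  proof (rule tendsto_sandwich[where f = "\<lambda>_. 0"])
    show "((\<lambda>F. N (sum f F - x) + N (sum g F - y)) \<longlongrightarrow> 0) (finite_subsets_at_top UNIV)"
      using assms by (intro tendsto_add_zero) (auto simp: absolutely_sums_def)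
    show "\<forall>\<^sub>F F in finite_subsets_at_top UNIV.
        N (sum (\<lambda>k. f k + g k) F - (x + y)) \<le> N (sum f F - x) + N (sum g F - y)"
      using N_triangle[OF step_diff step_diff] in_V
      by (intro always_eventually) (auto simp: sum.distrib step_sum add_diff_add)
  qed (auto simp: in_V step_sum step_add step_diff N_nonneg)
  ultimately show ?thesis by (simp add: absolutely_sums_def in_V step_add)
qed

lemma absolutely_sums_reindex:
  assumes "absolutely_sums V N f x" "bij \<pi>"
  shows "absolutely_sums V N (\<lambda>k. f (\<pi> k)) x"
proof -
  have inj: "inj \<pi>" and surj: "range \<pi> = UNIV" using assms(2) by (auto simp: bij_def)
  have "((\<lambda>F. N (sum f F - x)) \<longlongrightarrow> 0) (filtermap ((`) \<pi>) (finite_subsets_at_top UNIV))"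
    using assms(1) filtermap_image_finite_subsets_at_top[OF inj] surj
    by (simp add: absolutely_sums_def)
  then have "((\<lambda>F. N (sum f (\<pi> ` F) - x)) \<longlongrightarrow> 0) (finite_subsets_at_top UNIV)"
    by (simp add: filterlim_filtermap)
  moreover have "sum f (\<pi> ` F) = sum (\<lambda>k. f (\<pi> k)) F" for F
    using inj by (subst sum.reindex) (auto simp: inj_on_def)
  moreover have "(\<lambda>k. N (f (\<pi> k))) summable_on UNIV"
    using assms summable_on_reindex_bij_betw[of \<pi> UNIV UNIV "\<lambda>k. N (f k)"]
    by (simp add: absolutely_sums_def)
  ultimately show ?thesis using assms(1) by (simp add: absolutely_sums_def)
qed

lemma absolutely_sums_single: 
  assumes "x \<in> V"
  shows "absolutely_sums V N (\<lambda>k. if k = k0 then x else 0) x"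
proof -
  have "(\<lambda>k. N (if k = k0 then x else 0)) summable_on UNIV \<longleftrightarrow> (\<lambda>k. N x) summable_on {k0}"
    by (rule summable_on_cong_neutral) auto
  moreover have "((\<lambda>F. N (sum (\<lambda>k. if k = k0 then x else 0) F - x)) \<longlongrightarrow> 0) (finite_subsets_at_top UNIV)"
    by (rule tendsto_eventually)
      (auto simp: eventually_finite_subsets_at_top sum.delta intro!: exI[of _ "{k0}"])
  ultimately show ?thesis using assms by (simp add: absolutely_sums_def step_0)
qed

end

text \<open>An additive bounded map commutes with absolutely convergent sums. Inclusions, point
  evaluations, scalar multiplications and multiplications by a fixed element are all of this form.\<close>

lemma absolutely_sums_bounded_image:
  assumes "normed_step s V N" "normed_step s' V' N'" "absolutely_sums V N f x"
    and maps: "\<And>y. y \<in> V \<Longrightarrow> L y \<in> V'"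
    and add: "\<And>y z. y \<in> V \<Longrightarrow> z \<in> V \<Longrightarrow> L (y + z) = L y + L z"
    and bound: "\<And>y. y \<in> V \<Longrightarrow> N' (L y) \<le> K * N y"
  shows "absolutely_sums V' N' (\<lambda>k. L (f k)) (L x)"
proof -
  interpret V: normed_step s V N by fact
  interpret V': normed_step s' V' N' by fact
  have in_V: "f k \<in> V" "x \<in> V" for k using assms(3) by (auto simp: absolutely_sums_def)
  have L0: "L 0 = 0" using add[OF V.step_0 V.step_0] by simp
  have diff: "L (y - z) = L y - L z" if "y \<in> V" "z \<in> V" for y z
    using add[of "y - z" z] that by (simp add: V.step_diff)
  have sum: "L (sum f F) = (\<Sum>k\<in>F. L (f k))" for F
    by (induction F rule: infinite_finite_induct) (auto simp: L0 add in_V V.step_sum)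
  have "(\<lambda>k. K * N (f k)) summable_on UNIV"
    using assms(3) by (intro summable_on_cmult_right) (simp add: absolutely_sums_def)
  then have "(\<lambda>k. N' (L (f k))) summable_on UNIV"
    by (rule summable_on_comparison_test) (auto simp: in_V maps bound V'.N_nonneg)
  moreover have "((\<lambda>F. N' ((\<Sum>k\<in>F. L (f k)) - L x)) \<longlongrightarrow> 0) (finite_subsets_at_top UNIV)"
  proof (rule tendsto_sandwich[where f = "\<lambda>_. 0"])
    show "((\<lambda>F. K * N (sum f F - x)) \<longlongrightarrow> 0) (finite_subsets_at_top UNIV)"
      using assms(3) by (intro tendsto_mult_right_zero) (auto simp: absolutely_sums_def)
    have "N' ((\<Sum>k\<in>F. L (f k)) - L x) \<le> K * N (sum f F - x)" for F
      using bound[of "sum f F - x"] in_V by (simp add: diff sum V.step_diff V.step_sum)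
    then show "\<forall>\<^sub>F F in finite_subsets_at_top UNIV. N' ((\<Sum>k\<in>F. L (f k)) - L x) \<le> K * N (sum f F - x)"
      by simp
  qed (auto simp: in_V maps V'.step_sum V'.step_diff V'.N_nonneg)
  ultimately show ?thesis by (simp add: absolutely_sums_def in_V maps)
qed

lemma (in normed_step) absolutely_sums_scale:
  assumes "absolutely_sums V N f x"
  shows "absolutely_sums V N (\<lambda>k. s c (f k)) (s c x)"
  by (rule absolutely_sums_bounded_image[OF normed_step_axioms normed_step_axioms assms, where K = "cmod c"])
    (auto simp: step_scale scale_right_distrib N_scale)

lemma (in normed_step) absolutely_sums_diff:
  assumes "absolutely_sums V N f x" "absolutely_sums V N g y"
  shows "absolutely_sums V N (\<lambda>k. f k - g k) (x - y)"
  using absolutely_sums_add[OF assms(1) absolutely_sums_scale[OF assms(2), of "-1"]] by simp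

text \<open>The partial sums over \<open>{- k..k}\<close> form a Cauchy sequence. Its limit is the sum over the net of all
  finite sets as well, because every finite set of integers lies in such an interval and the tail
  outside it bounds all further changes.\<close>

lemma (in banach_step) absolutely_sums_exists:
  fixes f :: "int \<Rightarrow> 'a"
  assumes in_V: "\<And>k. f k \<in> V" and summable: "(\<lambda>k. N (f k)) summable_on UNIV"
  obtains x where "absolutely_sums V N f x"
proof -
  define J :: "nat \<Rightarrow> int set" where "J k = {- int k..int k}" for k
  have mono: "J k \<subseteq> J l" if "k \<le> l" for k l using that by (auto simp: J_def)
  have absorb: "\<exists>K. F \<subseteq> J K" if "finite F" for F :: "int set"
  proof -
    have "\<bar>n\<bar> \<le> Max (abs ` F)" if "n \<in> F" for n using that \<open>finite F\<close> by simp
    then have "F \<subseteq> J (nat (Max (abs ` F)))" by (fastforce simp: J_def)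
    then show ?thesis by blast
  qed
  have diff: "N (sum f G - sum f F) \<le> (\<Sum>\<^sub>\<infinity>k\<in>-F. N (f k))" if "finite G" "F \<subseteq> G" for F G
  proof -
    have "N (sum f G - sum f F) = N (sum f (G - F))" using sum_diff[OF that, of f] by simp
    also have "\<dots> \<le> (\<Sum>k\<in>G - F. N (f k))" using in_V by (intro N_sum_le)
    also have "\<dots> \<le> (\<Sum>\<^sub>\<infinity>k\<in>-F. N (f k))"
      using that in_V by (intro finite_sum_le_infsum summable_on_subset_banach[OF summable]) (auto simp: N_nonneg)
    finally show ?thesis .
  qed
  have small: "\<exists>K. (\<Sum>\<^sub>\<infinity>k\<in>-J K. N (f k)) < \<epsilon>" if "\<epsilon> > 0" for \<epsilon>
  proof -
    have "\<forall>\<^sub>F F in finite_subsets_at_top UNIV. (\<Sum>\<^sub>\<infinity>k\<in>-F. N (f k)) < \<epsilon>"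
      using order_tendstoD(2)[OF tendsto_infsum_Compl[OF summable] that] .
    then obtain F where F: "finite F" "\<And>G. finite G \<Longrightarrow> F \<subseteq> G \<Longrightarrow> (\<Sum>\<^sub>\<infinity>k\<in>-G. N (f k)) < \<epsilon>"
      by (auto simp: eventually_finite_subsets_at_top)
    obtain K where "F \<subseteq> J K" using absorb[OF F(1)] by blast
    then show ?thesis using F(2)[of "J K"] by (auto simp: J_def)
  qed
  have fin: "finite (J k)" for k by (simp add: J_def)
  obtain x where x: "x \<in> V" "(\<lambda>k. N (sum f (J k) - x)) \<longlonglongrightarrow> 0"
  proof (rule Cauchy_has_limit)
    show "sum f (J k) \<in> V" for k using in_V by (simp add: step_sum)
    fix \<epsilon> :: real assume "\<epsilon> > 0"
    then obtain K where K: "(\<Sum>\<^sub>\<infinity>k\<in>-J K. N (f k)) < \<epsilon> / 2" using small[of "\<epsilon> / 2"] by auto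
    have "N (sum f (J k) - sum f (J l)) < \<epsilon>" if "K \<le> k" "K \<le> l" for k l
    proof -
      have "N (sum f (J k) - sum f (J l)) \<le> N (sum f (J k) - sum f (J K)) + N (sum f (J K) - sum f (J l))"
        using in_V by (intro N_diff_triangle step_sum)
      moreover have "N (sum f (J K) - sum f (J l)) = N (sum f (J l) - sum f (J K))"
        using in_V by (intro N_diff_commute step_sum)
      ultimately show ?thesis
        using diff[OF fin mono[OF that(1)]] diff[OF fin mono[OF that(2)]] K by linarith
    qed
    then show "\<exists>K. \<forall>k l. K \<le> k \<longrightarrow> K \<le> l \<longrightarrow> N (sum f (J k) - sum f (J l)) < \<epsilon>" by blast
  qed
  have tail: "N (sum f F - x) \<le> (\<Sum>\<^sub>\<infinity>k\<in>-F. N (f k))" if "finite F" for F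
  proof -
    obtain K where K: "F \<subseteq> J K" using absorb[OF \<open>finite F\<close>] by blast
    have "(\<lambda>k. (\<Sum>\<^sub>\<infinity>k\<in>-F. N (f k)) + N (sum f (J k) - x)) \<longlonglongrightarrow> (\<Sum>\<^sub>\<infinity>k\<in>-F. N (f k)) + 0"
      using x by (intro tendsto_add) auto
    then have "N (sum f F - x) \<le> (\<Sum>\<^sub>\<infinity>k\<in>-F. N (f k)) + 0"
    proof (rule tendsto_lowerbound)
      have "N (sum f F - x) \<le> (\<Sum>\<^sub>\<infinity>k\<in>-F. N (f k)) + N (sum f (J k) - x)" if "K \<le> k" for k
      proof -
        have "N (sum f F - x) \<le> N (sum f F - sum f (J k)) + N (sum f (J k) - x)"
          using in_V x by (intro N_diff_triangle step_sum) auto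
        moreover have "N (sum f F - sum f (J k)) = N (sum f (J k) - sum f F)"
          using in_V by (intro N_diff_commute step_sum)
        ultimately show ?thesis using diff[OF fin, of F k] K mono[OF that] by fastforce
      qed
      then show "\<forall>\<^sub>F k in sequentially. N (sum f F - x) \<le> (\<Sum>\<^sub>\<infinity>k\<in>-F. N (f k)) + N (sum f (J k) - x)"
        using eventually_sequentially by blast
    qed simp
    then show ?thesis by simp
  qed
  have "((\<lambda>F. N (sum f F - x)) \<longlongrightarrow> 0) (finite_subsets_at_top UNIV)"
    by (rule tendsto_sandwich[OF _ _ tendsto_const tendsto_infsum_Compl[OF summable]])
      (auto intro!: eventually_finite_subsets_at_top_weakI tail simp: N_nonneg in_V x step_sum step_diff)
  then show ?thesis using that in_V summable x by (auto simp: absolutely_sums_def)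
qed


section \<open>Fourier expansions\<close>

definition fourier_char :: "int \<Rightarrow> real \<Rightarrow> complex" where
  "fourier_char n t = exp (\<i> * of_int n * of_real t)"

lemma fourier_char_0 [simp]: "fourier_char 0 t = 1" "fourier_char n 0 = 1"
  by (simp_all add: fourier_char_def)

lemma fourier_char_add: "fourier_char (m + n) t = fourier_char m t * fourier_char n t"
  by (simp add: fourier_char_def exp_add [symmetric] algebra_simps)

lemma cmod_fourier_char [simp]: "cmod (fourier_char n t) = 1"
  by (simp add: fourier_char_def)

text \<open>The values are the powers of an \<open>M\<close>-th root of unity, which is different from \<open>1\<close> because \<open>M\<close> does
  not divide a nonzero \<open>n\<close> of smaller modulus.\<close>

lemma sum_fourier_char_roots_of_unity:
  assumes "\<bar>n\<bar> < int M"
  shows "(\<Sum>j<M. fourier_char n (2 * pi * real j / real M)) = (if n = 0 then of_nat M else 0)"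
proof (cases "n = 0")
  case False
  define z where "z = exp (2 * of_real pi * \<i> * of_int n / of_nat M)"
  have M: "M > 0" using assms False by auto
  have power: "fourier_char n (2 * pi * real j / real M) = z ^ j" for j
    by (simp add: fourier_char_def z_def exp_of_nat_mult [symmetric] mult_ac)
  have "z ^ M = exp (2 * of_int n * of_real pi * \<i>)"
    using M by (simp add: z_def exp_of_nat_mult [symmetric] mult_ac)
  also have "\<dots> = 1" by (auto simp: exp_eq_1)
  finally have "z ^ M = 1" .
  moreover have "z \<noteq> 1"
  proof
    assume "z = 1"
    then obtain k :: int where "2 * pi * real_of_int n / real M = of_int (2 * k) * pi"
      by (auto simp: z_def exp_eq_1)
    then have "of_int n = (of_int (k * int M) :: real)" using M by (simp add: field_simps)
    then have "n = k * int M" by linarith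
    then show False using assms False by (auto simp: abs_mult)
  qed
  ultimately show ?thesis using False by (simp add: power sum_gp_strict)
qed simp

context normed_step
begin

lemma fourier_expansion_iff:
  "fourier_expansion s V N f c \<longleftrightarrow>
     (\<forall>t. absolutely_sums V N (\<lambda>n. s (fourier_char n t) (c n)) (f t))"
proof -
  have "c n \<in> V" if "s (fourier_char n t) (c n) \<in> V" for n t
    using step_scale[OF that, of "inverse (fourier_char n t)"] by (simp add: fourier_char_def)
  then have in_V: "(\<forall>n. s (fourier_char n t) (c n) \<in> V) \<longleftrightarrow> (\<forall>n. c n \<in> V)" for t
    by (meson step_scale)
  have norm: "(\<lambda>n. N (s (fourier_char n t) (c n))) = (\<lambda>n. N (c n))" if "\<forall>n. c n \<in> V" for t
    using that by (simp add: N_scale)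
  show ?thesis
    unfolding fourier_expansion_def absolutely_sums_iff_limitin in_V
    using norm by (auto simp: fourier_char_def)
qed

lemma fourier_expansionD:
  assumes "fourier_expansion s V N f c"
  shows "c n \<in> V" "(\<lambda>n. N (c n)) summable_on UNIV" "f t \<in> V"
    "absolutely_sums V N (\<lambda>n. s (fourier_char n t) (c n)) (f t)"
proof -
  show "c n \<in> V" "(\<lambda>n. N (c n)) summable_on UNIV"
    using assms by (auto simp: fourier_expansion_def)
  show "absolutely_sums V N (\<lambda>n. s (fourier_char n t) (c n)) (f t)"
    using assms by (simp add: fourier_expansion_iff)
  then show "f t \<in> V" by (simp add: absolutely_sums_def)
qed

lemma fourier_expansion_add:
  assumes "fourier_expansion s V N f c" "fourier_expansion s V N g d"
  shows "fourier_expansion s V N (f + g) (\<lambda>n. c n + d n)"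
  using assms absolutely_sums_add unfolding fourier_expansion_iff
  by (fastforce simp: scale_right_distrib)

lemma fourier_expansion_scale:
  assumes "fourier_expansion s V N f c"
  shows "fourier_expansion s V N (pointwise_scale s z f) (\<lambda>n. s z (c n))"
  using assms absolutely_sums_scale[of _ _ z] unfolding fourier_expansion_iff
  by (fastforce simp: pointwise_scale_def mult.commute)

lemma fourier_expansion_diff:
  assumes "fourier_expansion s V N f c" "fourier_expansion s V N g d"
  shows "fourier_expansion s V N (f - g) (\<lambda>n. c n - d n)"
  using assms absolutely_sums_diff unfolding fourier_expansion_iff
  by (fastforce simp: scale_right_diff_distrib)

lemma fourier_expansion_const:
  assumes "x \<in> V"
  shows "fourier_expansion s V N (\<lambda>t. x) (\<lambda>n. if n = 0 then x else 0)"
  unfolding fourier_expansion_iff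
proof
  fix t
  have "(\<lambda>n. s (fourier_char n t) (if n = 0 then x else 0)) = (\<lambda>n. if n = 0 then x else 0)"
    by auto
  then show "absolutely_sums V N (\<lambda>n. s (fourier_char n t) (if n = 0 then x else 0)) x"
    using absolutely_sums_single[OF assms] by simp
qed

text \<open>The usual argument integrates \<open>fourier_char (- m) t * f t\<close> over a period. Here the integral is
  replaced by the average over the \<open>M\<close> points \<open>2 * pi * j / M\<close>. Choose a finite set \<open>F\<close> containing \<open>m\<close>
  such that the coefficients outside \<open>F\<close> have total norm below \<open>\<epsilon>\<close>; then the trigonometric polynomial
  with the coefficients in \<open>F\<close> is within \<open>\<epsilon>\<close> of \<open>f = 0\<close> at every point. If \<open>M\<close> exceeds the distance of
  \<open>m\<close> to every index in \<open>F\<close>, averaging this polynomial against \<open>fourier_char (- m)\<close> returns exactly \<open>c m\<close>,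
  whence \<open>N (c m) \<le> \<epsilon>\<close>.\<close>

lemma fourier_coefficient_eq_0:
  assumes exp: "fourier_expansion s V N f c" and zero: "\<And>t. f t = 0"
  shows "c m = 0"
proof -
  note in_V = fourier_expansionD(1)[OF exp]
  have "N (c m) \<le> \<epsilon>" if "\<epsilon> > 0" for \<epsilon>
  proof -
    have "\<forall>\<^sub>F F in finite_subsets_at_top UNIV. (\<Sum>\<^sub>\<infinity>n\<in>-F. N (c n)) < \<epsilon>"
      using order_tendstoD(2)[OF tendsto_infsum_Compl[OF fourier_expansionD(2)[OF exp]] that] .
    then obtain F0 where "finite F0" "\<And>F. finite F \<Longrightarrow> F0 \<subseteq> F \<Longrightarrow> (\<Sum>\<^sub>\<infinity>n\<in>-F. N (c n)) < \<epsilon>"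
      by (auto simp: eventually_finite_subsets_at_top)
    then obtain F where F: "finite F" "m \<in> F" "(\<Sum>\<^sub>\<infinity>n\<in>-F. N (c n)) < \<epsilon>"
      by (metis finite_insert insertI1 subset_insertI)
    define M where "M = Suc (nat (Max ((\<lambda>n. \<bar>n - m\<bar>) ` F)))"
    have M: "\<bar>n - m\<bar> < int M" if "n \<in> F" for n
    proof -
      have "\<bar>n - m\<bar> \<le> Max ((\<lambda>n. \<bar>n - m\<bar>) ` F)" using that F(1) by simp
      then show ?thesis unfolding M_def by linarith
    qed
    have "M > 0" by (simp add: M_def)
    define t where "t j = 2 * pi * real j / real M" for j
    define v where "v j = (\<Sum>n\<in>F. s (fourier_char n (t j)) (c n))" for j
    have v: "v j \<in> V" for j using in_V by (simp add: v_def step_sum step_scale)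
    have v_small: "N (v j) \<le> \<epsilon>" for j
      using absolutely_sums_tail_le[OF fourier_expansionD(4)[OF exp, of "t j"] F(1)] F(3) in_V
      by (simp add: zero v_def N_scale)
    have "(\<Sum>j<M. s (fourier_char (- m) (t j)) (v j)) =
        (\<Sum>j<M. \<Sum>n\<in>F. s (fourier_char (n - m) (t j)) (c n))"
      using fourier_char_add[of "- m"] by (simp add: v_def scale_sum_right)
    also have "\<dots> = (\<Sum>n\<in>F. s (\<Sum>j<M. fourier_char (n - m) (t j)) (c n))"
      by (subst sum.swap) (simp add: scale_sum_left)
    also have "\<dots> = (\<Sum>n\<in>F. if n = m then s (of_nat M) (c m) else 0)"
      using M sum_fourier_char_roots_of_unity by (intro sum.cong) (auto simp: t_def)
    also have "\<dots> = s (of_nat M) (c m)" using F by simp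
    finally have "real M * N (c m) = N (\<Sum>j<M. s (fourier_char (- m) (t j)) (v j))"
      using in_V by (simp add: N_scale)
    also have "\<dots> \<le> (\<Sum>j<M. N (s (fourier_char (- m) (t j)) (v j)))"
      using v by (intro N_sum_le) (simp add: step_scale)
    also have "\<dots> \<le> (\<Sum>j<M. \<epsilon>)" using v v_small by (intro sum_mono) (simp add: N_scale)
    finally show ?thesis using \<open>M > 0\<close> by simp
  qed
  then have "N (c m) \<le> 0" by (rule field_le_epsilon[of _ 0, simplified])
  then show ?thesis using N_nonneg[OF in_V, of m] N_eq_0_iff[OF in_V, of m] by simp
qed

lemma fourier_expansion_unique:
  assumes "fourier_expansion s V N f c" "fourier_expansion s V N f d"
  shows "c = d"
proof
  fix n
  have "c n - d n = 0" by (rule fourier_coefficient_eq_0[OF fourier_expansion_diff[OF assms]]) simp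
  then show "c n = d n" by simp
qed

lemma wiener_coeffs_eq: "fourier_expansion s V N f c \<Longrightarrow> wiener_coeffs s V N f = c"
  unfolding wiener_coeffs_def using fourier_expansion_unique by blast

lemma fourier_expansion_wiener_coeffs:
  "f \<in> wiener_space s V N \<Longrightarrow> fourier_expansion s V N f (wiener_coeffs s V N f)"
  using wiener_coeffs_eq by (auto simp: wiener_space_def)

lemma wiener_norm_eq: "fourier_expansion s V N f c \<Longrightarrow> wiener_norm s V N f = (\<Sum>\<^sub>\<infinity>n. N (c n))"
  by (simp add: wiener_norm_def wiener_coeffs_eq)

lemma wiener_space_range: "f \<in> wiener_space s V N \<Longrightarrow> f t \<in> V"
  using fourier_expansionD(3) by (auto simp: wiener_space_def)

lemma const_in_wiener_space_iff: "(\<lambda>t. x) \<in> wiener_space s V N \<longleftrightarrow> x \<in> V"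
  using fourier_expansion_const wiener_space_range by (auto simp: wiener_space_def)

lemma norm_le_wiener_norm:
  assumes "f \<in> wiener_space s V N"
  shows "N (f t) \<le> wiener_norm s V N f"
proof -
  obtain c where c: "fourier_expansion s V N f c" using assms by (auto simp: wiener_space_def)
  show ?thesis
    using absolutely_sums_norm_le[OF fourier_expansionD(4)[OF c]] fourier_expansionD(1)[OF c]
    by (simp add: wiener_norm_eq[OF c] N_scale)
qed

end


section \<open>The Wiener space of a Banach space\<close>

lemma vector_space_pointwise_scale:
  assumes "vector_space s"
  shows "vector_space (pointwise_scale s)"
proof -
  interpret vector_space s by fact
  show ?thesis
    by unfold_locales (auto simp: pointwise_scale_def fun_eq_iff scale_right_distrib scale_left_distrib)
qed

context normed_step
begin

lemma normed_step_wiener_space: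
  "normed_step (pointwise_scale s) (wiener_space s V N) (wiener_norm s V N)"
proof -
  let ?W = "wiener_space s V N" and ?NW = "wiener_norm s V N"
  interpret W: vector_space "pointwise_scale s"
    by (intro vector_space_pointwise_scale) unfold_locales
  have "W.subspace ?W"
    using fourier_expansion_add fourier_expansion_scale fourier_expansion_const[OF step_0]
    by (intro W.subspaceI) (auto simp: wiener_space_def zero_fun_def, blast+)
  moreover have "0 \<le> ?NW f" if "f \<in> ?W" for f
    using that by (auto simp: wiener_space_def wiener_norm_eq fourier_expansionD N_nonneg intro!: infsum_nonneg)
  moreover have "?NW f = 0 \<longleftrightarrow> f = 0" if f: "f \<in> ?W" for f
  proof
    assume "?NW f = 0"
    then have "N (f t) = 0" for t
      using norm_le_wiener_norm[OF f, of t] N_nonneg[OF wiener_space_range[OF f], of t] by simp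
    then show "f = 0" using N_eq_0_iff wiener_space_range[OF f] by (auto simp: fun_eq_iff)
  next
    assume "f = 0"
    then show "?NW f = 0"
      using wiener_norm_eq[OF fourier_expansion_const[OF step_0]]
      by (simp add: zero_fun_def)
  qed
  moreover have "?NW (pointwise_scale s z f) = cmod z * ?NW f" if f: "f \<in> ?W" for z f
  proof -
    obtain c where c: "fourier_expansion s V N f c" using f by (auto simp: wiener_space_def)
    show ?thesis
      using fourier_expansionD[OF c]
      by (simp add: wiener_norm_eq[OF c] wiener_norm_eq[OF fourier_expansion_scale[OF c]] N_scale
          infsum_cmult_right)
  qed
  moreover have "?NW (f + g) \<le> ?NW f + ?NW g" if fg: "f \<in> ?W" "g \<in> ?W" for f g
  proof -
    obtain c d where c: "fourier_expansion s V N f c" and d: "fourier_expansion s V N g d"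
      using fg by (auto simp: wiener_space_def)
    have "(\<Sum>\<^sub>\<infinity>n. N (c n + d n)) \<le> (\<Sum>\<^sub>\<infinity>n. N (c n) + N (d n))"
      using fourier_expansionD[OF c] fourier_expansionD[OF d]
        fourier_expansionD(2)[OF fourier_expansion_add[OF c d]]
      by (intro infsum_mono summable_on_add N_triangle) auto
    also have "\<dots> = (\<Sum>\<^sub>\<infinity>n. N (c n)) + (\<Sum>\<^sub>\<infinity>n. N (d n))"
      using fourier_expansionD[OF c] fourier_expansionD[OF d] by (intro infsum_add)
    finally show ?thesis
      by (simp add: wiener_norm_eq[OF c] wiener_norm_eq[OF d] wiener_norm_eq[OF fourier_expansion_add[OF c d]])
  qed
  ultimately show ?thesis
    by unfold_locales (auto simp: normed_subspace_def)
qed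

end

context banach_step
begin

lemma fourier_expansion_exists:
  assumes "\<And>n. c n \<in> V" "(\<lambda>n. N (c n)) summable_on UNIV"
  obtains f where "fourier_expansion s V N f c"
proof -
  have "\<exists>x. absolutely_sums V N (\<lambda>n. s (fourier_char n t) (c n)) x" for t
  proof (rule absolutely_sums_exists)
    show "s (fourier_char n t) (c n) \<in> V" for n using assms(1) by (rule step_scale)
    show "(\<lambda>n. N (s (fourier_char n t) (c n))) summable_on UNIV"
      using assms by (simp add: N_scale)
  qed blast
  then have "fourier_expansion s V N (\<lambda>t. SOME x. absolutely_sums V N (\<lambda>n. s (fourier_char n t) (c n)) x) c"
    unfolding fourier_expansion_iff by (auto intro: someI_ex)
  then show ?thesis by (rule that)
qed

text \<open>Coefficientwise this is completeness of \<open>\<ell>\<^sup>1\<close>: each coefficient of a Cauchy sequence converges, and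
  the Cauchy estimate, taken over finitely many indices, survives passing to the limit in one of its
  two arguments. Uniqueness of coefficients is what turns the norm of a difference of functions into
  the sum of the differences of coefficients.\<close>

lemma banach_step_wiener_space:
  "banach_step (pointwise_scale s) (wiener_space s V N) (wiener_norm s V N)"
proof -
  let ?W = "wiener_space s V N" and ?NW = "wiener_norm s V N"
  interpret W: normed_step "pointwise_scale s" ?W ?NW by (rule normed_step_wiener_space)
  have "\<exists>f. limitin W.dist.mtopology \<sigma> f sequentially" if "W.dist.MCauchy \<sigma>" for \<sigma>
  proof -
    have \<sigma>: "\<sigma> k \<in> ?W" for k using that by (simp add: W.MCauchy_iff)
    define c where "c k = wiener_coeffs s V N (\<sigma> k)" for k
    have c: "fourier_expansion s V N (\<sigma> k) (c k)" for k
      using \<sigma> by (simp add: c_def fourier_expansion_wiener_coeffs)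
    note c_V = fourier_expansionD(1)[OF c]
    have partial: "(\<Sum>n\<in>F. N (c k n - c l n)) \<le> ?NW (\<sigma> k - \<sigma> l)" if "finite F" for F k l
      using fourier_expansion_diff[OF c c, of k l] that
      by (auto simp: wiener_norm_eq intro!: finite_sum_le_infsum dest: fourier_expansionD simp: N_nonneg step_diff c_V)
    have Cauchy: "\<exists>K. \<forall>k l. K \<le> k \<longrightarrow> K \<le> l \<longrightarrow> ?NW (\<sigma> k - \<sigma> l) < \<epsilon>" if "\<epsilon> > 0" for \<epsilon>
      using that \<open>W.dist.MCauchy \<sigma>\<close> by (simp add: W.MCauchy_iff)
    have "\<exists>x. x \<in> V \<and> (\<lambda>k. N (c k n - x)) \<longlonglongrightarrow> 0" for n
    proof (rule Cauchy_has_limit[of "\<lambda>k. c k n"])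
      fix \<epsilon> :: real assume "\<epsilon> > 0"
      then obtain K where "\<And>k l. K \<le> k \<Longrightarrow> K \<le> l \<Longrightarrow> ?NW (\<sigma> k - \<sigma> l) < \<epsilon>" using Cauchy by metis
      moreover have "N (c k n - c l n) \<le> ?NW (\<sigma> k - \<sigma> l)" for k l
        using partial[of "{n}" k l] by simp
      ultimately show "\<exists>K. \<forall>k l. K \<le> k \<longrightarrow> K \<le> l \<longrightarrow> N (c k n - c l n) < \<epsilon>"
        by (meson le_less_trans)
    qed (use c_V in auto)
    then obtain d where d: "d n \<in> V" "(\<lambda>k. N (c k n - d n)) \<longlonglongrightarrow> 0" for n by metis
    have close: "(\<lambda>n. N (c k n - d n)) summable_on UNIV \<and> (\<Sum>\<^sub>\<infinity>n. N (c k n - d n)) \<le> \<epsilon>"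
      if K: "\<And>k l. K \<le> k \<Longrightarrow> K \<le> l \<Longrightarrow> ?NW (\<sigma> k - \<sigma> l) < \<epsilon>" and k: "K \<le> k" for K \<epsilon> k
    proof -
      \<comment> \<open>Insert \<open>c l\<close> between \<open>c k\<close> and \<open>d\<close>; on a finite set of indices the second part vanishes
        as \<open>l\<close> grows.\<close>
      have "(\<Sum>n\<in>F. N (c k n - d n)) \<le> \<epsilon>" if "finite F" for F
      proof -
        have "(\<lambda>l. \<epsilon> + (\<Sum>n\<in>F. N (c l n - d n))) \<longlonglongrightarrow> \<epsilon> + (\<Sum>n\<in>F. 0)"
          using d by (intro tendsto_intros) auto
        then have "(\<Sum>n\<in>F. N (c k n - d n)) \<le> \<epsilon> + (\<Sum>n\<in>F. 0)"
        proof (rule tendsto_lowerbound)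
          have "(\<Sum>n\<in>F. N (c k n - d n)) \<le> \<epsilon> + (\<Sum>n\<in>F. N (c l n - d n))" if "K \<le> l" for l
          proof -
            have "(\<Sum>n\<in>F. N (c k n - d n)) \<le> (\<Sum>n\<in>F. N (c k n - c l n) + N (c l n - d n))"
              using c_V d by (intro sum_mono N_diff_triangle) auto
            then show ?thesis
              using partial[OF \<open>finite F\<close>, of k l] K[OF k that] by (simp add: sum.distrib)
          qed
          then show "\<forall>\<^sub>F l in sequentially. (\<Sum>n\<in>F. N (c k n - d n)) \<le> \<epsilon> + (\<Sum>n\<in>F. N (c l n - d n))"
            using eventually_sequentially by blast
        qed simp
        then show ?thesis by simp
      qed
      then show ?thesis
        using summable_on_if_bounded[of "\<lambda>n. N (c k n - d n)" \<epsilon>] c_V d by (simp add: N_nonneg step_diff)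
    qed
    \<comment> \<open>The limit coefficients are summable because they differ from those of a single member
      of the sequence by a summable family.\<close>
    obtain K where K: "\<And>k l. K \<le> k \<Longrightarrow> K \<le> l \<Longrightarrow> ?NW (\<sigma> k - \<sigma> l) < 1"
      using Cauchy[of 1] by (meson zero_less_one)
    have "(\<lambda>n. N (c K n) + N (c K n - d n)) summable_on UNIV"
      using close[OF K] fourier_expansionD(2)[OF c] by (intro summable_on_add) auto
    moreover have "N (d n) \<le> N (c K n) + N (c K n - d n)" for n
      using N_triangle[of "c K n" "d n - c K n"] c_V d by (simp add: step_diff N_diff_commute)
    ultimately have "(\<lambda>n. N (d n)) summable_on UNIV"
      using d by (elim summable_on_comparison_test) (auto simp: N_nonneg)
    then obtain f where f: "fourier_expansion s V N f d" using fourier_expansion_exists d by metis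
    then have "f \<in> ?W" by (auto simp: wiener_space_def)
    have "\<exists>K. \<forall>k\<ge>K. ?NW (\<sigma> k - f) < \<epsilon>" if "\<epsilon> > 0" for \<epsilon>
    proof -
      obtain K where K: "\<And>k l. K \<le> k \<Longrightarrow> K \<le> l \<Longrightarrow> ?NW (\<sigma> k - \<sigma> l) < \<epsilon> / 2"
        using Cauchy[of "\<epsilon> / 2"] \<open>\<epsilon> > 0\<close> by (meson half_gt_zero)
      have "?NW (\<sigma> k - f) \<le> \<epsilon> / 2" if "K \<le> k" for k
        using close[OF K that] wiener_norm_eq[OF fourier_expansion_diff[OF c f]] by simp
      then have "\<forall>k\<ge>K. ?NW (\<sigma> k - f) < \<epsilon>" using \<open>\<epsilon> > 0\<close> by force
      then show ?thesis by blast
    qed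
    then have "limitin W.dist.mtopology \<sigma> f sequentially"
      using \<sigma> \<open>f \<in> ?W\<close> by (simp add: W.dist.limit_metric_sequentially norm_dist_def)
    then show ?thesis by blast
  qed
  then show ?thesis
    by unfold_locales (auto simp: W.dist.mcomplete_def)
qed

end


text \<open>A bounded inclusion keeps the expansion of a function, so the coefficients with respect to the
  two spaces agree and the norms can be compared term by term.\<close>

lemma wiener_space_inclusion:
  assumes "normed_step s V N" "normed_step s W M" "V \<subseteq> W"
    and bound: "\<And>x. x \<in> V \<Longrightarrow> M x \<le> K * N x"
    and f: "f \<in> wiener_space s V N"
  shows "f \<in> wiener_space s W M" "wiener_norm s W M f \<le> K * wiener_norm s V N f"
proof -
  interpret V: normed_step s V N by fact
  interpret W: normed_step s W M by fact
  obtain c where c: "fourier_expansion s V N f c" using f by (auto simp: wiener_space_def)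
  have c': "fourier_expansion s W M f c"
    unfolding W.fourier_expansion_iff
    using absolutely_sums_bounded_image[OF assms(1,2) V.fourier_expansionD(4)[OF c], of "\<lambda>x. x" K]
      assms(3) bound by auto
  then show "f \<in> wiener_space s W M" by (auto simp: wiener_space_def)
  have "(\<Sum>\<^sub>\<infinity>n. M (c n)) \<le> (\<Sum>\<^sub>\<infinity>n. K * N (c n))"
    using V.fourier_expansionD[OF c] W.fourier_expansionD[OF c'] bound
    by (intro infsum_mono summable_on_cmult_right) auto
  also have "\<dots> = K * (\<Sum>\<^sub>\<infinity>n. N (c n))"
    using V.fourier_expansionD[OF c] by (simp add: infsum_cmult_right)
  finally show "wiener_norm s W M f \<le> K * wiener_norm s V N f"
    by (simp add: V.wiener_norm_eq[OF c] W.wiener_norm_eq[OF c'])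
qed

section \<open>Products in the Wiener space\<close>

text \<open>The product is abstract so that left and right multiplication in an algebra are both instances,
  the second one with the factors interchanged.\<close>

locale bounded_product =
  V: normed_step s V N + W: banach_step s W M
  for s :: "complex \<Rightarrow> 'a::ab_group_add \<Rightarrow> 'a" and V N W M +
  fixes mul :: "'a \<Rightarrow> 'a \<Rightarrow> 'a" and C :: real
  assumes mul_in: "x \<in> V \<Longrightarrow> y \<in> W \<Longrightarrow> mul x y \<in> W"
    and mul_bound: "x \<in> V \<Longrightarrow> y \<in> W \<Longrightarrow> M (mul x y) \<le> C * N x * M y"
    and mul_add_left: "mul (x + x') y = mul x y + mul x' y"
    and mul_add_right: "mul x (y + y') = mul x y + mul x y'"
    and mul_scale_left: "mul (s z x) y = s z (mul x y)"
    and mul_scale_right: "mul x (s z y) = s z (mul x y)"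
begin

text \<open>The product with a single term \<open>fourier_char k t\<close> times \<open>x\<close> applies a bounded map to all coefficients
  and shifts their indices by \<open>k\<close>.\<close>

lemma monomial_product:
  assumes x: "x \<in> V" and d: "fourier_expansion s W M g d"
  shows "fourier_expansion s W M (\<lambda>t. mul (s (fourier_char k t) x) (g t)) (\<lambda>n. mul x (d (n - k)))"
    and "wiener_norm s W M (\<lambda>t. mul (s (fourier_char k t) x) (g t)) \<le> C * N x * wiener_norm s W M g"
proof -
  have bij: "bij (\<lambda>n. n - k)" by (rule bij_betwI[of _ _ _ "\<lambda>n. n + k"]) auto
  show expansion: "fourier_expansion s W M (\<lambda>t. mul (s (fourier_char k t) x) (g t)) (\<lambda>n. mul x (d (n - k)))"
    unfolding W.fourier_expansion_iff
  proof
    fix t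
    let ?y = "s (fourier_char k t) x"
    have "?y \<in> V" using x by (rule V.step_scale)
    then have "absolutely_sums W M (\<lambda>n. mul ?y (s (fourier_char n t) (d n))) (mul ?y (g t))"
      using mul_in mul_bound mul_add_right
      by (intro absolutely_sums_bounded_image[OF W.normed_step_axioms W.normed_step_axioms W.fourier_expansionD(4)[OF d],
          where K = "C * N ?y"]) auto
    then have "absolutely_sums W M (\<lambda>n. mul ?y (s (fourier_char (n - k) t) (d (n - k)))) (mul ?y (g t))"
      by (rule W.absolutely_sums_reindex[OF _ bij])
    moreover have "mul ?y (s (fourier_char (n - k) t) (d (n - k))) = s (fourier_char n t) (mul x (d (n - k)))" for n
      using fourier_char_add[of "n - k" k t] by (simp add: mul_scale_left mul_scale_right mult.commute)
    ultimately show "absolutely_sums W M (\<lambda>n. s (fourier_char n t) (mul x (d (n - k)))) (mul ?y (g t))"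
      by simp
  qed
  have "(\<Sum>\<^sub>\<infinity>n. M (mul x (d (n - k)))) \<le> (\<Sum>\<^sub>\<infinity>n. C * N x * M (d (n - k)))"
    using W.fourier_expansionD[OF expansion] W.fourier_expansionD[OF d] x
      summable_on_reindex_bij_betw[OF bij, of "\<lambda>n. M (d n)"]
    by (intro infsum_mono summable_on_cmult_right mul_bound) auto
  also have "\<dots> = C * N x * (\<Sum>\<^sub>\<infinity>n. M (d (n - k)))"
    using W.fourier_expansionD[OF d] summable_on_reindex_bij_betw[OF bij, of "\<lambda>n. M (d n)"]
    by (simp add: infsum_cmult_right)
  also have "(\<Sum>\<^sub>\<infinity>n. M (d (n - k))) = (\<Sum>\<^sub>\<infinity>n. M (d n))"
    by (rule infsum_reindex_bij_betw[OF bij])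
  finally show "wiener_norm s W M (\<lambda>t. mul (s (fourier_char k t) x) (g t)) \<le> C * N x * wiener_norm s W M g"
    by (simp add: W.wiener_norm_eq[OF expansion] W.wiener_norm_eq[OF d])
qed

text \<open>Expand the first factor only. The terms of its series multiplied by \<open>g\<close> lie in the Wiener space of
  \<open>W\<close> and are absolutely summable there, so by completeness they have a sum \<open>h\<close> whose norm obeys the
  required bound. At each point, evaluation is bounded on the Wiener space and multiplication by
  \<open>g t\<close> is bounded on \<open>V\<close>, so \<open>h t\<close> and the product are sums of the same series in \<open>W\<close>. This avoids
  rearranging the double series of the convolution.\<close>

theorem wiener_product:
  assumes f: "f \<in> wiener_space s V N" and g: "g \<in> wiener_space s W M"
  shows "(\<lambda>t. mul (f t) (g t)) \<in> wiener_space s W M"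
    and "wiener_norm s W M (\<lambda>t. mul (f t) (g t)) \<le> C * wiener_norm s V N f * wiener_norm s W M g"
proof -
  let ?Y = "wiener_space s W M" and ?NY = "wiener_norm s W M"
  interpret Y: banach_step "pointwise_scale s" ?Y ?NY by (rule W.banach_step_wiener_space)
  obtain c where c: "fourier_expansion s V N f c" using f by (auto simp: wiener_space_def)
  obtain d where d: "fourier_expansion s W M g d" using g by (auto simp: wiener_space_def)
  define p where "p k = (\<lambda>t. mul (s (fourier_char k t) (c k)) (g t))" for k
  have p: "p k \<in> ?Y" "?NY (p k) \<le> C * ?NY g * N (c k)" for k
    using monomial_product[OF V.fourier_expansionD(1)[OF c] d]
    by (auto simp: p_def wiener_space_def mult_ac)
  have sum: "(\<lambda>k. C * ?NY g * N (c k)) summable_on UNIV"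
    using V.fourier_expansionD(2)[OF c] by (rule summable_on_cmult_right)
  then have sum_p: "(\<lambda>k. ?NY (p k)) summable_on UNIV"
    by (rule summable_on_comparison_test) (auto simp: Y.N_nonneg p)
  obtain h where h: "absolutely_sums ?Y ?NY p h" using Y.absolutely_sums_exists p(1) sum_p by blast
  have h_eq: "h t = mul (f t) (g t)" for t
  proof (rule W.absolutely_sums_unique)
    show "absolutely_sums W M (\<lambda>k. p k t) (h t)"
      using W.wiener_space_range W.norm_le_wiener_norm
      by (intro absolutely_sums_bounded_image[OF Y.normed_step_axioms W.normed_step_axioms h,
          where L = "\<lambda>h. h t" and K = 1]) auto
    have "M (mul y (g t)) \<le> C * M (g t) * N y" if "y \<in> V" for y
      using mul_bound[OF that W.wiener_space_range[OF g], of t] by (simp add: mult_ac)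
    then show "absolutely_sums W M (\<lambda>k. p k t) (mul (f t) (g t))"
      unfolding p_def using mul_in mul_add_left W.wiener_space_range[OF g]
      by (intro absolutely_sums_bounded_image[OF V.normed_step_axioms W.normed_step_axioms V.fourier_expansionD(4)[OF c],
          where L = "\<lambda>y. mul y (g t)" and K = "C * M (g t)"]) auto
  qed
  then have h_fun: "h = (\<lambda>t. mul (f t) (g t))" by auto
  show "(\<lambda>t. mul (f t) (g t)) \<in> ?Y" using h unfolding h_fun by (simp add: absolutely_sums_def)
  have "?NY h \<le> (\<Sum>\<^sub>\<infinity>k. ?NY (p k))" using h by (rule Y.absolutely_sums_norm_le)
  also have "\<dots> \<le> (\<Sum>\<^sub>\<infinity>k. C * ?NY g * N (c k))" using sum_p sum p(2) by (rule infsum_mono)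
  also have "\<dots> = C * ?NY g * (\<Sum>\<^sub>\<infinity>k. N (c k))"
    using V.fourier_expansionD(2)[OF c] by (simp add: infsum_cmult_right)
  finally show "?NY (\<lambda>t. mul (f t) (g t)) \<le> C * wiener_norm s V N f * ?NY g"
    by (simp add: h_fun V.wiener_norm_eq[OF c] mult_ac)
qed

end

section \<open>The Wiener algebra\<close>

context banach_inductive_limit
begin

lemma steps_banach_step: "\<alpha> \<in> I \<Longrightarrow> banach_step s (X \<alpha>) (N \<alpha>)"
  using steps_banach vector_space_axioms by (simp add: banach_step_iff)

lemma steps_normed_step: "\<alpha> \<in> I \<Longrightarrow> normed_step s (X \<alpha>) (N \<alpha>)"
  using steps_banach_step by (rule banach_step.axioms)

lemma step_norm_bound:
  assumes "\<alpha> \<in> I" "\<beta> \<in> I" "X \<alpha> \<subseteq> X \<beta>"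
  obtains K where "K > 0" "\<And>x. x \<in> X \<alpha> \<Longrightarrow> N \<beta> x \<le> K * N \<alpha> x"
  using coarser_iff_bounded[OF steps_normed_step steps_normed_step] steps_coarser assms by metis

text \<open>Constant functions recover a step from its Wiener space. Hence the Wiener spaces are indexed in
  the same order as the steps, and distinct steps have distinct Wiener spaces.\<close>

lemma wiener_space_subset_iff:
  assumes "\<alpha> \<in> I" "\<beta> \<in> I"
  shows "wiener_space s (X \<alpha>) (N \<alpha>) \<subseteq> wiener_space s (X \<beta>) (N \<beta>) \<longleftrightarrow> X \<alpha> \<subseteq> X \<beta>"
proof
  assume *: "wiener_space s (X \<alpha>) (N \<alpha>) \<subseteq> wiener_space s (X \<beta>) (N \<beta>)"
  show "X \<alpha> \<subseteq> X \<beta>"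
    using * normed_step.const_in_wiener_space_iff[OF steps_normed_step] assms by blast
next
  assume "X \<alpha> \<subseteq> X \<beta>"
  then show "wiener_space s (X \<alpha>) (N \<alpha>) \<subseteq> wiener_space s (X \<beta>) (N \<beta>)"
    using wiener_space_inclusion(1)[OF steps_normed_step steps_normed_step] step_norm_bound assms by (metis subsetI)
qed

theorem banach_inductive_limit_wiener:
  defines "U \<equiv> wiener_carrier s I X N"
    and "Y \<equiv> (\<lambda>\<alpha>. wiener_space s (X \<alpha>) (N \<alpha>))"
    and "NY \<equiv> (\<lambda>\<alpha>. wiener_norm s (X \<alpha>) (N \<alpha>))"
  shows "banach_inductive_limit (pointwise_scale s) U I Y NY
           (inductive_limit_topology (pointwise_scale s) U I Y NY)"
proof -
  interpret F: vector_space "pointwise_scale s"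
    by (rule vector_space_pointwise_scale[OF vector_space_axioms])
  have Y: "banach_step (pointwise_scale s) (Y \<alpha>) (NY \<alpha>)" if "\<alpha> \<in> I" for \<alpha>
    unfolding Y_def NY_def using steps_banach_step[OF that] by (rule banach_step.banach_step_wiener_space)
  then have Y': "normed_step (pointwise_scale s) (Y \<alpha>) (NY \<alpha>)" if "\<alpha> \<in> I" for \<alpha>
    using that by (blast intro: banach_step.axioms)
  have U: "U = (\<Union>\<alpha>\<in>I. Y \<alpha>)" by (simp add: U_def Y_def wiener_carrier_def)
  have subset: "Y \<alpha> \<subseteq> Y \<beta> \<longleftrightarrow> X \<alpha> \<subseteq> X \<beta>" if "\<alpha> \<in> I" "\<beta> \<in> I" for \<alpha> \<beta>
    unfolding Y_def using that by (rule wiener_space_subset_iff)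
  have directed: "\<exists>\<gamma>\<in>I. Y \<alpha> \<subseteq> Y \<gamma> \<and> Y \<beta> \<subseteq> Y \<gamma>" if "\<alpha> \<in> I" "\<beta> \<in> I" for \<alpha> \<beta>
    using steps_directed[OF that] subset that by blast
  have subspace: "F.subspace U"
  proof (rule F.subspaceI)
    obtain \<alpha> where "\<alpha> \<in> I" using subspace_0[OF carrier_subspace] carrier_eq by auto
    then show "0 \<in> U" using normed_step.step_0[OF Y'] by (auto simp: U)
  next
    fix f g assume "f \<in> U" "g \<in> U"
    then obtain \<alpha> \<beta> where "\<alpha> \<in> I" "\<beta> \<in> I" "f \<in> Y \<alpha>" "g \<in> Y \<beta>" by (auto simp: U)
    then obtain \<gamma> where "\<gamma> \<in> I" "f \<in> Y \<gamma>" "g \<in> Y \<gamma>" using directed by blast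
    then show "f + g \<in> U" using normed_step.step_add[OF Y'] by (auto simp: U)
  next
    fix z f assume "f \<in> U"
    then show "pointwise_scale s z f \<in> U" using normed_step.step_scale[OF Y'] by (auto simp: U)
  qed
  show ?thesis
  proof unfold_locales
    show "F.subspace U" by (fact subspace)
    show "U = (\<Union>\<alpha>\<in>I. Y \<alpha>)" by (fact U)
    show "inj_on Y I"
      using steps_distinct subset unfolding inj_on_def by (metis set_eq_subset)
    show "\<exists>\<gamma>\<in>I. Y \<alpha> \<subseteq> Y \<gamma> \<and> Y \<beta> \<subseteq> Y \<gamma>" if "\<alpha> \<in> I" "\<beta> \<in> I" for \<alpha> \<beta>
      using that by (rule directed)
    show "banach_subspace (pointwise_scale s) (Y \<alpha>) (NY \<alpha>)" if "\<alpha> \<in> I" for \<alpha>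
      using Y[OF that] by (simp add: banach_step_iff)
    show "openin (norm_topology (Y \<alpha>) (NY \<alpha>)) O'"
      if "\<alpha> \<in> I" "\<beta> \<in> I" "Y \<alpha> \<subseteq> Y \<beta>" "openin (subtopology (norm_topology (Y \<beta>) (NY \<beta>)) (Y \<alpha>)) O'"
      for \<alpha> \<beta> O'
    proof -
      have le: "X \<alpha> \<subseteq> X \<beta>" using that subset by simp
      obtain K where "K > 0" "\<And>x. x \<in> X \<alpha> \<Longrightarrow> N \<beta> x \<le> K * N \<alpha> x"
        using step_norm_bound[OF \<open>\<alpha> \<in> I\<close> \<open>\<beta> \<in> I\<close> le] by blast
      then have "\<exists>K>0. \<forall>f\<in>Y \<alpha>. NY \<beta> f \<le> K * NY \<alpha> f"
        using wiener_space_inclusion(2)[OF steps_normed_step[OF that(1)] steps_normed_step[OF that(2)] le]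
        unfolding Y_def NY_def by blast
      then show ?thesis
        using coarser_iff_bounded[OF Y'[OF that(1)] Y'[OF that(2)] that(3)] that(4) by blast
    qed
    show "is_inductive_limit_topology (pointwise_scale s) U I Y NY
        (inductive_limit_topology (pointwise_scale s) U I Y NY)"
    proof (rule is_inductive_limit_topology_inductive_limit_topology)
      show "topspace (norm_topology (Y \<alpha>) (NY \<alpha>)) \<subseteq> U" if "\<alpha> \<in> I" for \<alpha>
        using that by (auto simp: normed_step.topspace_norm_topology[OF Y'] U)
    qed (fact F.vector_space_axioms subspace)+
  qed
qed

end

theorem proposition5p3:
  fixes s :: "complex \<Rightarrow> 'a::ring \<Rightarrow> 'a"
    and E :: "'a set" and I :: "'i set" and X :: "'i \<Rightarrow> 'a set"
    and N :: "'i \<Rightarrow> 'a \<Rightarrow> real" and T :: "'a topology"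
  assumes "unital_strong_algebra s E I X N T"
  defines "U \<equiv> wiener_carrier s I X N"
    and "Y \<equiv> (\<lambda>\<alpha>. wiener_space s (X \<alpha>) (N \<alpha>))"
    and "NY \<equiv> (\<lambda>\<alpha>. wiener_norm s (X \<alpha>) (N \<alpha>))"
  shows "strong_algebra (pointwise_scale s) U I Y NY
           (inductive_limit_topology (pointwise_scale s) U I Y NY)"
proof -
  interpret unital_strong_algebra s E I X N T by fact
  interpret W: banach_inductive_limit "pointwise_scale s" U I Y NY
      "inductive_limit_topology (pointwise_scale s) U I Y NY"
    unfolding U_def Y_def NY_def by (rule banach_inductive_limit_wiener)
  have subset: "Y \<alpha> \<subseteq> Y \<beta> \<longleftrightarrow> X \<alpha> \<subseteq> X \<beta>" if "\<alpha> \<in> I" "\<beta> \<in> I" for \<alpha> \<beta>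
    unfolding Y_def using that by (rule wiener_space_subset_iff)
  have strong_Y: "\<exists>h\<in>I. \<forall>\<beta>\<in>I. Y h \<subseteq> Y \<beta> \<longrightarrow>
      (\<exists>C>0. \<forall>f\<in>Y \<alpha>. \<forall>g\<in>Y \<beta>.
         f * g \<in> Y \<beta> \<and> NY \<beta> (f * g) \<le> C * NY \<alpha> f * NY \<beta> g \<and>
         g * f \<in> Y \<beta> \<and> NY \<beta> (g * f) \<le> C * NY \<alpha> f * NY \<beta> g)" if \<alpha>: "\<alpha> \<in> I" for \<alpha>
  proof -
    obtain h where "h \<in> I" and h: "\<And>\<beta>. \<beta> \<in> I \<Longrightarrow> X h \<subseteq> X \<beta> \<Longrightarrow>
        \<exists>C>0. \<forall>a\<in>X \<alpha>. \<forall>b\<in>X \<beta>.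
         a * b \<in> X \<beta> \<and> N \<beta> (a * b) \<le> C * N \<alpha> a * N \<beta> b \<and>
         b * a \<in> X \<beta> \<and> N \<beta> (b * a) \<le> C * N \<alpha> a * N \<beta> b"
      using strong[OF \<alpha>] by blast
    have "\<exists>C>0. \<forall>f\<in>Y \<alpha>. \<forall>g\<in>Y \<beta>.
         f * g \<in> Y \<beta> \<and> NY \<beta> (f * g) \<le> C * NY \<alpha> f * NY \<beta> g \<and>
         g * f \<in> Y \<beta> \<and> NY \<beta> (g * f) \<le> C * NY \<alpha> f * NY \<beta> g"
      if \<beta>: "\<beta> \<in> I" and "Y h \<subseteq> Y \<beta>" for \<beta>
    proof -
      have "X h \<subseteq> X \<beta>" using that \<open>h \<in> I\<close> subset by simp
      then obtain C where "C > 0" and C: "\<And>a b. a \<in> X \<alpha> \<Longrightarrow> b \<in> X \<beta> \<Longrightarrow>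
         a * b \<in> X \<beta> \<and> N \<beta> (a * b) \<le> C * N \<alpha> a * N \<beta> b \<and>
         b * a \<in> X \<beta> \<and> N \<beta> (b * a) \<le> C * N \<alpha> a * N \<beta> b"
        using h[OF \<beta>] by blast
      note steps = steps_normed_step[OF \<alpha>] steps_banach_step[OF \<beta>]
      interpret left: bounded_product s "X \<alpha>" "N \<alpha>" "X \<beta>" "N \<beta>" "\<lambda>a b. a * b" C
        using C by (intro bounded_product.intro bounded_product_axioms.intro steps)
          (auto simp: algebra_simps scale_mult_left scale_mult_right)
      interpret right: bounded_product s "X \<alpha>" "N \<alpha>" "X \<beta>" "N \<beta>" "\<lambda>a b. b * a" C
        using C by (intro bounded_product.intro bounded_product_axioms.intro steps)
          (auto simp: algebra_simps scale_mult_left scale_mult_right)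
      show ?thesis
        using \<open>C > 0\<close> left.wiener_product right.wiener_product
        unfolding Y_def NY_def times_fun_def by blast
    qed
    then show ?thesis using \<open>h \<in> I\<close> by blast
  qed
  show ?thesis
  proof unfold_locales
    fix z :: complex and f g :: "real \<Rightarrow> 'a"
    show "pointwise_scale s z f * g = pointwise_scale s z (f * g)"
      by (simp add: pointwise_scale_def fun_eq_iff scale_mult_left)
    show "f * pointwise_scale s z g = pointwise_scale s z (f * g)"
      by (simp add: pointwise_scale_def fun_eq_iff scale_mult_right)
  next
    fix f g assume "f \<in> U" "g \<in> U"
    then obtain \<alpha> \<beta> where \<alpha>: "\<alpha> \<in> I" "f \<in> Y \<alpha>" and \<beta>: "\<beta> \<in> I" "g \<in> Y \<beta>"
      by (auto simp: W.carrier_eq)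
    \<comment> \<open>A common upper bound of \<open>\<beta>\<close> and \<open>h(\<alpha>)\<close> is a step that contains \<open>g\<close> and on which
      multiplication by \<open>f\<close> acts.\<close>
    obtain h where "h \<in> I" and h: "\<And>\<gamma>. \<gamma> \<in> I \<Longrightarrow> Y h \<subseteq> Y \<gamma> \<Longrightarrow> \<forall>f\<in>Y \<alpha>. \<forall>g\<in>Y \<gamma>. f * g \<in> Y \<gamma>"
      using strong_Y[OF \<alpha>(1)] by metis
    obtain \<gamma> where "\<gamma> \<in> I" "Y h \<subseteq> Y \<gamma>" "Y \<beta> \<subseteq> Y \<gamma>"
      using W.steps_directed[OF \<open>h \<in> I\<close> \<beta>(1)] by blast
    then show "f * g \<in> U" using h \<alpha> \<beta> unfolding W.carrier_eq by blast
  next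
    fix \<alpha> assume "\<alpha> \<in> I"
    then show "\<exists>h\<in>I. \<forall>\<beta>\<in>I. Y h \<subseteq> Y \<beta> \<longrightarrow>
      (\<exists>C>0. \<forall>f\<in>Y \<alpha>. \<forall>g\<in>Y \<beta>.
         f * g \<in> Y \<beta> \<and> NY \<beta> (f * g) \<le> C * NY \<alpha> f * NY \<beta> g \<and>
         g * f \<in> Y \<beta> \<and> NY \<beta> (g * f) \<le> C * NY \<alpha> f * NY \<beta> g)"
      by (rule strong_Y)
  qed
qed

end
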